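(* Let $g\in L^2(\mathbb{R}^d)$, $g\neq 0$, be a window function, and let $S\subseteq L^2(\mathbb{R}^d)$ be a closed and bounded set. Then the following statements are equivalent: (i) $S$ is compact in $L^2(\mathbb{R}^d)$. (ii) The set $\{\mathcal{S}_g f : f\in S\}$ is tight in $L^2(\mathbb{R}^{2d})$, i.e., for every $\epsilon>0$ there exists a compact set $U\subseteq\mathbb{R}^{2d}$ such that $$\sup_{f\in S}\Big(\int_{U^c}|\mathcal{S}_g f(x,\omega)|^2\,dx\,d\omega\Big)^{1/2}<\epsilon .$$
   Context: For $(x,\omega)\in\mathbb{R}^{2d}$ the time-frequency shift of $g$ is $M_\omega T_x g(t)=e^{2\pi i t\cdot\omega}g(t-x)$. The short-time Fourier transform of $f\in L^2(\mathbb{R}^d)$ with respect to the window $g\in L^2(\mathbb{R}^d)$ is $$\mathcal{S}_g f(x,\omega)=\int_{\mathbb{R}^d}f(t)\,\overline{g(t-x)}\,e^{-2\pi i\omega\cdot t}\,dt=\langle f,M_\omega T_x g\rangle .$$ $U^c$ denotes the complement of $U$ in $\mathbb{R}^{2d}$. *)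

theory Defs
  imports "HOL-Analysis.Analysis"
begin

section \<open>The Hilbert space of square-integrable functions\<close>

definition square_integrable :: "('a::euclidean_space \<Rightarrow> complex) \<Rightarrow> bool" where
  "square_integrable f \<longleftrightarrow>
     f \<in> borel_measurable lborel \<and> integrable lborel (\<lambda>x. (norm (f x))\<^sup>2)"

lemma square_integrable_measurable [measurable_dest]:
  "square_integrable f \<Longrightarrow> f \<in> borel_measurable lborel"
  by (simp add: square_integrable_def)

lemma square_integrable_zero: "square_integrable (\<lambda>x. 0)"
  by (simp add: square_integrable_def)

lemma square_integrable_scaleR:
  assumes "square_integrable f"
  shows "square_integrable (\<lambda>x. c *\<^sub>R f x)"
  using assms by (auto simp: square_integrable_def power_mult_distrib)

lemma square_integrable_add:
  assumes f: "square_integrable f" and g: "square_integrable g"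
  shows "square_integrable (\<lambda>x. f x + g x)"
proof -
  note [measurable] = square_integrable_measurable[OF f] square_integrable_measurable[OF g]
  have "(norm (a + b))\<^sup>2 \<le> 2 * (norm a)\<^sup>2 + 2 * (norm b)\<^sup>2" for a b :: complex
  proof -
    have "(norm (a + b))\<^sup>2 \<le> (norm a + norm b)\<^sup>2"
      by (intro power_mono norm_triangle_ineq) simp
    also have "\<dots> \<le> 2 * (norm a)\<^sup>2 + 2 * (norm b)\<^sup>2"
      using sum_squares_bound[of "norm a" "norm b"] by (simp add: power2_sum)
    finally show ?thesis .
  qed
  then have bound: "AE x in lborel. norm ((norm (f x + g x))\<^sup>2) \<le>
      norm (2 * (norm (f x))\<^sup>2 + 2 * (norm (g x))\<^sup>2)"
    by simp
  have "integrable lborel (\<lambda>x. 2 * (norm (f x))\<^sup>2 + 2 * (norm (g x))\<^sup>2)"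
    using f g by (simp add: square_integrable_def)
  then have "integrable lborel (\<lambda>x. (norm (f x + g x))\<^sup>2)"
    by (rule Bochner_Integration.integrable_bound[OF _ _ bound]) measurable
  then show ?thesis
    by (simp add: square_integrable_def)
qed

lemma square_integrable_uminus:
  "square_integrable f \<Longrightarrow> square_integrable (\<lambda>x. - f x)"
  using square_integrable_scaleR[of f "- 1"] by simp

lemma square_integrable_diff:
  "square_integrable f \<Longrightarrow> square_integrable g \<Longrightarrow> square_integrable (\<lambda>x. f x - g x)"
  using square_integrable_add[of f "\<lambda>x. - g x"] square_integrable_uminus[of g] by simp

lemma integrable_inner_square_integrable:
  assumes f: "square_integrable f" and g: "square_integrable g"
  shows "integrable lborel (\<lambda>x. f x \<bullet> g x)"
proof (rule Bochner_Integration.integrable_bound)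
  note [measurable] = square_integrable_measurable[OF f] square_integrable_measurable[OF g]
  show "integrable lborel (\<lambda>x. (norm (f x))\<^sup>2 + (norm (g x))\<^sup>2)"
    using f g by (auto simp: square_integrable_def)
  show "(\<lambda>x. f x \<bullet> g x) \<in> borel_measurable lborel"
    by measurable
  have "norm (a \<bullet> b) \<le> norm ((norm a)\<^sup>2 + (norm b)\<^sup>2)" for a b :: complex
  proof -
    have "\<bar>a \<bullet> b\<bar> \<le> norm a * norm b"
      by (rule Cauchy_Schwarz_ineq2)
    also have "\<dots> \<le> (norm a)\<^sup>2 + (norm b)\<^sup>2"
      using sum_squares_bound[of "norm a" "norm b"] mult_nonneg_nonneg[OF norm_ge_zero norm_ge_zero, of a b]
      by linarith
    finally show ?thesis by simp
  qed
  then show "AE x in lborel. norm (f x \<bullet> g x) \<le> norm ((norm (f x))\<^sup>2 + (norm (g x))\<^sup>2)"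
    by simp
qed

definition l2_rel :: "('a::euclidean_space \<Rightarrow> complex) \<Rightarrow> ('a \<Rightarrow> complex) \<Rightarrow> bool" where
  "l2_rel f g \<longleftrightarrow> square_integrable f \<and> square_integrable g \<and> (AE x in lborel. f x = g x)"

lemma l2_rel_sym: "l2_rel f g \<Longrightarrow> l2_rel g f"
  by (simp add: l2_rel_def eq_commute)

lemma l2_rel_trans:
  assumes "l2_rel f g" "l2_rel g h"
  shows "l2_rel f h"
proof -
  have "AE x in lborel. f x = g x" "AE x in lborel. g x = h x"
    using assms by (simp_all add: l2_rel_def)
  then have "AE x in lborel. f x = h x"
    by eventually_elim simp
  with assms show ?thesis
    by (simp add: l2_rel_def)
qed

lemma l2_rel_add:
  assumes "l2_rel f f'" "l2_rel g g'"
  shows "l2_rel (\<lambda>x. f x + g x) (\<lambda>x. f' x + g' x)"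
proof -
  have "AE x in lborel. f x = f' x" "AE x in lborel. g x = g' x"
    using assms by (simp_all add: l2_rel_def)
  then have "AE x in lborel. f x + g x = f' x + g' x"
    by eventually_elim simp
  with assms show ?thesis
    by (simp add: l2_rel_def square_integrable_add)
qed

lemma l2_rel_scaleR:
  assumes "l2_rel f f'"
  shows "l2_rel (\<lambda>x. c *\<^sub>R f x) (\<lambda>x. c *\<^sub>R f' x)"
proof -
  have "AE x in lborel. f x = f' x"
    using assms by (simp add: l2_rel_def)
  then have "AE x in lborel. c *\<^sub>R f x = c *\<^sub>R f' x"
    by eventually_elim simp
  with assms show ?thesis
    by (simp add: l2_rel_def square_integrable_scaleR del: scaleR_cancel_left)
qed

lemma l2_rel_uminus: "l2_rel f f' \<Longrightarrow> l2_rel (\<lambda>x. - f x) (\<lambda>x. - f' x)"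
  using l2_rel_scaleR[of f f' "- 1"] by simp

lemma l2_rel_diff:
  assumes "l2_rel f f'" "l2_rel g g'"
  shows "l2_rel (\<lambda>x. f x - g x) (\<lambda>x. f' x - g' x)"
  using l2_rel_add[OF assms(1) l2_rel_uminus[OF assms(2)]] by simp

lemma part_equivp_l2_rel: "part_equivp l2_rel"
proof (rule part_equivpI)
  show "\<exists>f. l2_rel f f"
    by (rule exI[of _ "\<lambda>x. 0"]) (simp add: l2_rel_def square_integrable_zero)
qed (auto intro: sympI transpI l2_rel_sym l2_rel_trans)

quotient_type (overloaded) 'a l2 = "'a::euclidean_space \<Rightarrow> complex" / partial: l2_rel
  by (rule part_equivp_l2_rel)

instantiation l2 :: (euclidean_space) real_vector
begin

lift_definition zero_l2 :: "'a l2" is "\<lambda>x. 0"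
  by (simp add: l2_rel_def square_integrable_zero)

lift_definition plus_l2 :: "'a l2 \<Rightarrow> 'a l2 \<Rightarrow> 'a l2" is "\<lambda>f g x. f x + g x"
  by (rule l2_rel_add)

lift_definition uminus_l2 :: "'a l2 \<Rightarrow> 'a l2" is "\<lambda>f x. - f x"
  by (rule l2_rel_uminus)

lift_definition minus_l2 :: "'a l2 \<Rightarrow> 'a l2 \<Rightarrow> 'a l2" is "\<lambda>f g x. f x - g x"
  by (rule l2_rel_diff)

lift_definition scaleR_l2 :: "real \<Rightarrow> 'a l2 \<Rightarrow> 'a l2" is "\<lambda>c f x. c *\<^sub>R f x"
  by (rule l2_rel_scaleR)

instance
proof
  fix f g h :: "'a l2" and a b :: real
  show "f + g + h = f + (g + h)"
    by transfer (simp add: l2_rel_def add.assoc square_integrable_add)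
  show "f + g = g + f"
    by transfer (simp add: l2_rel_def add.commute square_integrable_add)
  show "0 + f = f"
    by transfer (simp add: l2_rel_def)
  show "- f + f = 0"
    by transfer (simp add: l2_rel_def square_integrable_zero)
  show "f - g = f + - g"
    by transfer (simp add: l2_rel_def square_integrable_diff)
  show "a *\<^sub>R (f + g) = a *\<^sub>R f + a *\<^sub>R g"
    by transfer (simp add: l2_rel_def scaleR_add_right square_integrable_add square_integrable_scaleR)
  show "(a + b) *\<^sub>R f = a *\<^sub>R f + b *\<^sub>R f"
    by transfer (simp add: l2_rel_def scaleR_add_left square_integrable_add square_integrable_scaleR)
  show "a *\<^sub>R b *\<^sub>R f = (a * b) *\<^sub>R f"
    by transfer (simp add: l2_rel_def square_integrable_scaleR)
  show "1 *\<^sub>R f = f"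
    by transfer (simp add: l2_rel_def)
qed

end

text \<open>
  As a real inner product space, \<open>f \<bullet> g\<close> is the real part of the usual complex inner product
  \<open>\<integral> f(x) cnj (g(x)) dx\<close>; on \<^typ>\<open>complex\<close>, \<open>a \<bullet> b = Re (a * cnj b)\<close>.  The norm, the metric and the
  topology are therefore the usual ones of the complex Hilbert space.
\<close>

instantiation l2 :: (euclidean_space) real_inner
begin

lift_definition inner_l2 :: "'a l2 \<Rightarrow> 'a l2 \<Rightarrow> real" is "\<lambda>f g. LINT x|lborel. f x \<bullet> g x"
proof -
  fix f f' g g' :: "'a \<Rightarrow> complex"
  assume f: "l2_rel f f'" and g: "l2_rel g g'"
  have [measurable]: "f \<in> borel_measurable borel" "f' \<in> borel_measurable borel"
      "g \<in> borel_measurable borel" "g' \<in> borel_measurable borel"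
    using f g by (simp_all add: l2_rel_def square_integrable_def)
  have "AE x in lborel. f x = f' x" "AE x in lborel. g x = g' x"
    using f g by (simp_all add: l2_rel_def)
  then have "AE x in lborel. f x \<bullet> g x = f' x \<bullet> g' x"
    by eventually_elim simp
  then show "(LINT x|lborel. f x \<bullet> g x) = (LINT x|lborel. f' x \<bullet> g' x)"
    by (intro integral_cong_AE) measurable
qed

definition norm_l2 :: "'a l2 \<Rightarrow> real" where
  "norm_l2 f = sqrt (inner f f)"

definition sgn_l2 :: "'a l2 \<Rightarrow> 'a l2" where
  "sgn_l2 f = f /\<^sub>R norm f"

definition dist_l2 :: "'a l2 \<Rightarrow> 'a l2 \<Rightarrow> real" where
  "dist_l2 f g = norm (f - g)"

definition uniformity_l2 :: "('a l2 \<times> 'a l2) filter" where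
  "uniformity_l2 = (INF e\<in>{0<..}. principal {(f, g). dist f g < e})"

definition open_l2 :: "'a l2 set \<Rightarrow> bool" where
  "open_l2 U \<longleftrightarrow> (\<forall>f\<in>U. eventually (\<lambda>(f', g). f' = f \<longrightarrow> g \<in> U) uniformity)"

instance
proof
  fix f g h :: "'a l2" and r :: real
  show "sgn f = f /\<^sub>R norm f"
    by (rule sgn_l2_def)
  show "dist f g = norm (f - g)"
    by (rule dist_l2_def)
  show "(uniformity :: ('a l2 \<times> 'a l2) filter) = (INF e\<in>{0<..}. principal {(f, g). dist f g < e})"
    by (rule uniformity_l2_def)
  show "open U \<longleftrightarrow> (\<forall>f\<in>U. eventually (\<lambda>(f', g). f' = f \<longrightarrow> g \<in> U) uniformity)"
    for U :: "'a l2 set"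
    by (rule open_l2_def)
  show "f \<bullet> g = g \<bullet> f"
    by transfer (simp add: inner_commute)
  show "(f + g) \<bullet> h = f \<bullet> h + g \<bullet> h"
    by transfer (simp add: l2_rel_def inner_add_left integrable_inner_square_integrable)
  show "(r *\<^sub>R f) \<bullet> g = r * (f \<bullet> g)"
    by transfer simp
  show "0 \<le> f \<bullet> f"
    by transfer simp
  show "f \<bullet> f = 0 \<longleftrightarrow> f = 0"
  proof (transfer)
    fix f :: "'a \<Rightarrow> complex"
    assume "l2_rel f f"
    then have f: "square_integrable f"
      by (simp add: l2_rel_def)
    have "(LINT x|lborel. f x \<bullet> f x) = 0 \<longleftrightarrow> (AE x in lborel. f x \<bullet> f x = 0)"
      by (intro integral_nonneg_eq_0_iff_AE integrable_inner_square_integrable f) simp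
    then show "(LINT x|lborel. f x \<bullet> f x) = 0 \<longleftrightarrow> l2_rel f (\<lambda>x. 0)"
      using f by (simp add: l2_rel_def square_integrable_zero)
  qed
  show "norm f = sqrt (f \<bullet> f)"
    by (rule norm_l2_def)
qed

end


section \<open>Short-time Fourier transform\<close>

lemma AE_lborel_translate:
  fixes x :: "'a::euclidean_space"
  assumes "AE t in lborel. P t"
  shows "AE t in lborel. P (t - x)"
proof -
  have eq: "distr lborel borel ((+) (- x)) = (lborel :: 'a measure)"
    using lborel_distr_plus[of "- x"] by simp
  have "AE t in distr lborel borel ((+) (- x)). P t"
    unfolding eq by (rule assms)
  then have "AE t in lborel. P (- x + t)"
    by (rule AE_distrD[rotated]) simp
  then show ?thesis by simp
qed

lift_definition stft :: "'a::euclidean_space l2 \<Rightarrow> 'a l2 \<Rightarrow> 'a \<times> 'a \<Rightarrow> complex" is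
  "\<lambda>g f (x, \<omega>). LINT t|lborel. f t * cnj (g (t - x)) * exp (- 2 * pi * \<i> * (\<omega> \<bullet> t))"
proof -
  fix g g' f f' :: "'a \<Rightarrow> complex"
  assume g: "l2_rel g g'" and f: "l2_rel f f'"
  have [measurable]: "g \<in> borel_measurable borel" "g' \<in> borel_measurable borel"
      "f \<in> borel_measurable borel" "f' \<in> borel_measurable borel"
    using f g by (simp_all add: l2_rel_def square_integrable_def)
  have [measurable]: "cnj \<in> borel_measurable borel" "(exp :: complex \<Rightarrow> complex) \<in> borel_measurable borel"
    by (intro borel_measurable_continuous_onI continuous_intros)+
  have "(LINT t|lborel. f t * cnj (g (t - x)) * exp (- 2 * pi * \<i> * (\<omega> \<bullet> t))) =
        (LINT t|lborel. f' t * cnj (g' (t - x)) * exp (- 2 * pi * \<i> * (\<omega> \<bullet> t)))" for x \<omega>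
  proof (rule integral_cong_AE)
    have "AE t in lborel. g (t - x) = g' (t - x)"
      using g by (intro AE_lborel_translate) (simp add: l2_rel_def)
    moreover have "AE t in lborel. f t = f' t"
      using f by (simp add: l2_rel_def)
    ultimately show "AE t in lborel. f t * cnj (g (t - x)) * exp (- 2 * pi * \<i> * (\<omega> \<bullet> t)) =
        f' t * cnj (g' (t - x)) * exp (- 2 * pi * \<i> * (\<omega> \<bullet> t))"
      by eventually_elim simp
  qed measurable
  then show "(\<lambda>(x, \<omega>). LINT t|lborel. f t * cnj (g (t - x)) * exp (- 2 * pi * \<i> * (\<omega> \<bullet> t))) =
        (\<lambda>(x, \<omega>). LINT t|lborel. f' t * cnj (g' (t - x)) * exp (- 2 * pi * \<i> * (\<omega> \<bullet> t)))"
    by auto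
qed


section \<open>Tightness\<close>

text \<open>
  The norm \<open>(\<integral>\<^bsub>A\<^esub> |F|\<^sup>2)\<^sup>1\<^sup>/\<^sup>2\<close> and the supremum in \<open>l2_tight\<close> take values in \<^typ>\<open>ennreal\<close>:
  a divergent integral is \<open>\<infinity>\<close>, an unbounded family has supremum \<open>\<infinity>\<close>, and the supremum over the
  empty family is \<open>0\<close>.
\<close>

definition l2_norm_on :: "'b::euclidean_space set \<Rightarrow> ('b \<Rightarrow> complex) \<Rightarrow> ennreal" where
  "l2_norm_on A F =
     (let I = \<integral>\<^sup>+z\<in>A. ennreal ((norm (F z))\<^sup>2) \<partial>lborel
      in if I = \<infinity> then \<infinity> else ennreal (sqrt (enn2real I)))"

definition l2_tight :: "('b::euclidean_space \<Rightarrow> complex) set \<Rightarrow> bool" where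
  "l2_tight \<F> \<longleftrightarrow>
     (\<forall>\<epsilon>::real. \<epsilon> > 0 \<longrightarrow>
        (\<exists>U. compact U \<and> (SUP F\<in>\<F>. l2_norm_on (- U) F) < ennreal \<epsilon>))"

end

theory Submission
  imports Defs "HOL-Probability.Characteristic_Functions" "HOL-Complex_Analysis.Great_Picard"
begin

text \<open>
  The theorem rests on two properties of the short-time Fourier transform: it preserves energy up to the
  factor \<open>(norm g)\<^sup>2\<close>, and its modulus of continuity is controlled by the norm of \<open>f\<close> alone.

  Energy preservation is Moyal's identity \<open>\<integral>|stft g f|\<^sup>2 = (norm g)\<^sup>2 (norm f)\<^sup>2\<close> (lemma \<open>moyal\<close>).  At a
  fixed position \<open>x\<close> the transform is the Fourier transform of \<open>t \<mapsto> f t * cnj (g (t - x))\<close>, so the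
  identity follows from Plancherel's identity and Tonelli's theorem.  Plancherel's identity for a function
  \<open>F\<close> that is both integrable and square-integrable (lemma \<open>plancherel\<close>) comes from inserting a Gaussian
  cut-off at frequency scale \<open>r\<close>.  By Fubini's theorem the truncated energy equals an average, at scale
  \<open>1 / r\<close>, of the autocorrelation of \<open>F\<close>.  The autocorrelation is continuous at \<open>0\<close> because translations are
  continuous in mean square, and letting \<open>r\<close> grow gives the identity.

  If \<open>S\<close> is compact, a finite net of \<open>S\<close> has short-time Fourier transforms that are concentrated, up to a
  small energy, on one compact set.  By Moyal's identity the same set serves all of \<open>S\<close>
  (lemma \<open>compact_imp_stft_tight\<close>).

  Conversely, let the transforms be tight.  The transforms of a bounded sequence are uniformly bounded, and
  they are equicontinuous because time-frequency shifts of \<open>g\<close> are continuous in mean square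
  (lemma \<open>stft_equicontinuous\<close>).  By the Arzela-Ascoli theorem two members of the sequence have transforms
  that are nearly equal on a prescribed compact set, and tightness makes the energy outside it negligible.
  By Moyal's identity, applied now as a lower bound with \<open>g \<noteq> 0\<close>, these two members are close.  Hence \<open>S\<close>
  contains no infinite separated sequence, that is, \<open>S\<close> is totally bounded
  (lemma \<open>stft_tight_imp_totally_bounded\<close>).  As a closed subset of a complete space, \<open>S\<close> is compact.
\<close>

section \<open>Measurability and changes of variables\<close>

lemma measurable_cnj [measurable]: "cnj \<in> borel_measurable borel"
  by (intro borel_measurable_continuous_onI continuous_intros)

lemma measurable_exp_complex [measurable]: "(exp :: complex \<Rightarrow> complex) \<in> borel_measurable borel"
  by (intro borel_measurable_continuous_onI continuous_intros)

lemma integrable_translate: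
  fixes x :: "'a::euclidean_space" and f :: "'a \<Rightarrow> 'b::{banach,second_countable_topology}"
  assumes "integrable lborel f"
  shows "integrable lborel (\<lambda>t. f (x + t))"
proof -
  have "integrable (distr lborel borel ((+) x)) f"
    using assms by (simp add: lborel_distr_plus)
  then show ?thesis by (rule integrable_distr[rotated]) simp
qed

lemma integral_translate:
  fixes x :: "'a::euclidean_space" and f :: "'a \<Rightarrow> 'b::{banach,second_countable_topology}"
  assumes [measurable]: "f \<in> borel_measurable borel"
  shows "(LINT t|lborel. f (x + t)) = (LINT t|lborel. f t)"
proof -
  have "(LINT t|lborel. f t) = (LINT t|(distr lborel borel ((+) x)). f t)"
    by (simp add: lborel_distr_plus)
  then show ?thesis by (simp add: integral_distr)
qed

lemma integral_scaleR_arg: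
  fixes f :: "'a::euclidean_space \<Rightarrow> 'b::{banach,second_countable_topology}"
  assumes [measurable]: "f \<in> borel_measurable borel" and "c \<noteq> 0"
  shows "(LINT x|lborel. f x) = (\<bar>c\<bar> ^ DIM('a)) *\<^sub>R (LINT x|lborel. f (c *\<^sub>R x))"
proof -
  have "(LINT x|lborel. f x) =
      (LINT x|density (distr lborel borel (\<lambda>x. 0 + c *\<^sub>R x)) (\<lambda>_. \<bar>c\<bar>^DIM('a)). f x)"
    using lborel_affine[of c "0::'a"] assms by simp
  also have "\<dots> = (LINT x|distr lborel borel (\<lambda>x::'a. 0 + c *\<^sub>R x). (\<bar>c\<bar> ^ DIM('a)) *\<^sub>R f x)"
    by (subst integral_density) simp_all
  also have "\<dots> = (\<bar>c\<bar> ^ DIM('a)) *\<^sub>R (LINT x|lborel. f (c *\<^sub>R x))"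
    by (simp add: integral_distr)
  finally show ?thesis .
qed

lemma integrable_scaleR_arg:
  fixes f :: "'a::euclidean_space \<Rightarrow> 'b::{banach,second_countable_topology}"
  assumes "integrable lborel f" and "c \<noteq> 0"
  shows "integrable lborel (\<lambda>x. f (c *\<^sub>R x))"
proof -
  have [measurable]: "f \<in> borel_measurable borel" using assms(1) by auto
  have "integrable (density (distr lborel borel (\<lambda>x. 0 + c *\<^sub>R x)) (\<lambda>_. \<bar>c\<bar>^DIM('a))) f"
    using lborel_affine[of c "0::'a"] assms by simp
  then have "integrable (distr lborel borel (\<lambda>x::'a. 0 + c *\<^sub>R x)) (\<lambda>x. (\<bar>c\<bar> ^ DIM('a)) *\<^sub>R f x)"
    by (subst (asm) integrable_density) simp_all
  then have "integrable (distr lborel borel (\<lambda>x::'a. 0 + c *\<^sub>R x)) f"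
    using assms(2) integrable_scaleR_right[of "inverse (\<bar>c\<bar> ^ DIM('a))" _
        "\<lambda>x. (\<bar>c\<bar> ^ DIM('a)) *\<^sub>R f x"] by simp
  then show ?thesis
    by (subst (asm) integrable_distr_eq) simp_all
qed

section \<open>Continuity of translations in the mean\<close>

definition L1_translation_continuous :: "('a::euclidean_space \<Rightarrow> real) \<Rightarrow> bool" where
  "L1_translation_continuous h \<longleftrightarrow>
     (\<forall>X. X \<longlonglongrightarrow> 0 \<longrightarrow> (\<lambda>n. LINT t|lborel. \<bar>h (X n + t) - h t\<bar>) \<longlonglongrightarrow> 0)"

text \<open>
  Translations are isometries of \<open>L\<^sup>1\<close>, so an approximation error of \<open>h\<close> enters the translate of
  \<open>h\<close> and \<open>h\<close> itself with the same size, uniformly in the translation.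
\<close>
lemma L1_translation_continuous_approx:
  fixes h :: "'a::euclidean_space \<Rightarrow> real"
  assumes h: "integrable lborel h"
    and approx: "\<And>e. 0 < e \<Longrightarrow> \<exists>k. integrable lborel k \<and> L1_translation_continuous k \<and>
                   (LINT t|lborel. \<bar>h t - k t\<bar>) \<le> e"
  shows "L1_translation_continuous h"
  unfolding L1_translation_continuous_def
proof (intro allI impI LIMSEQ_I)
  fix X :: "nat \<Rightarrow> 'a" and r :: real
  assume X: "X \<longlonglongrightarrow> 0" and r: "0 < r"
  obtain k where k: "integrable lborel k" "L1_translation_continuous k"
      and hk: "(LINT t|lborel. \<bar>h t - k t\<bar>) \<le> r / 4"
    using approx[of "r / 4"] r by auto
  have "(\<lambda>n. LINT t|lborel. \<bar>k (X n + t) - k t\<bar>) \<longlonglongrightarrow> 0"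
    using k(2) X by (auto simp: L1_translation_continuous_def)
  from LIMSEQ_D[OF this, of "r / 4"] r obtain N
    where N: "\<And>n. n \<ge> N \<Longrightarrow> (LINT t|lborel. \<bar>k (X n + t) - k t\<bar>) < r / 4" by fastforce
  have [measurable]: "h \<in> borel_measurable borel" "k \<in> borel_measurable borel"
    using h k by auto
  have "norm ((LINT t|lborel. \<bar>h (X n + t) - h t\<bar>) - 0) < r" if n: "n \<ge> N" for n
  proof -
    note int = integrable_translate[OF h, of "X n"] integrable_translate[OF k(1), of "X n"] h k(1)
    have "(LINT t|lborel. \<bar>h (X n + t) - h t\<bar>) \<le>
        (LINT t|lborel. \<bar>h (X n + t) - k (X n + t)\<bar> + \<bar>k (X n + t) - k t\<bar> + \<bar>h t - k t\<bar>)"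
      using int by (intro integral_mono integrable_abs Bochner_Integration.integrable_add
          Bochner_Integration.integrable_diff) auto
    also have "\<dots> = (LINT t|lborel. \<bar>h (X n + t) - k (X n + t)\<bar>) + (LINT t|lborel. \<bar>k (X n + t) - k t\<bar>)
        + (LINT t|lborel. \<bar>h t - k t\<bar>)"
      using int by simp
    also have "(LINT t|lborel. \<bar>h (X n + t) - k (X n + t)\<bar>) = (LINT t|lborel. \<bar>h t - k t\<bar>)"
      by (rule integral_translate[where f="\<lambda>t. \<bar>h t - k t\<bar>"]) measurable
    finally show ?thesis using hk N[OF n] r by (simp add: integral_nonneg_AE)
  qed
  then show "\<exists>no. \<forall>n\<ge>no. norm ((LINT t|lborel. \<bar>h (X n + t) - h t\<bar>) - 0) < r"
    by blast
qed

text \<open>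
  For an open set the loss \<open>max (1\<^sub>U(t) - 1\<^sub>U(x + t)) 0\<close> tends to \<open>0\<close> pointwise, because a point of
  \<open>U\<close> stays in \<open>U\<close> under a small translation.  The gain may fail to tend to \<open>0\<close> on the boundary of \<open>U\<close>,
  but it has the same integral as the loss, since translations preserve the measure of \<open>U\<close>.
\<close>
lemma L1_translation_continuous_indicator_open:
  fixes U :: "'a::euclidean_space set"
  assumes U: "open U" "emeasure lborel U < \<infinity>"
  shows "L1_translation_continuous (indicator U)"
  unfolding L1_translation_continuous_def
proof (intro allI impI)
  fix X :: "nat \<Rightarrow> 'a" assume X: "X \<longlonglongrightarrow> 0"
  have [measurable]: "U \<in> sets borel" using U by simp
  have int: "integrable lborel (indicator U :: 'a \<Rightarrow> real)"
    using U by (intro integrable_real_indicator) auto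
  let ?p = "\<lambda>n t. max (indicator U t - indicator U (X n + t)) (0::real)"
  have "(\<lambda>n. LINT t|lborel. ?p n t) \<longlonglongrightarrow> (LINT t|(lborel :: 'a measure). (0::real))"
  proof (rule integral_dominated_convergence[OF _ _ int])
    have "(\<lambda>n. ?p n t) \<longlonglongrightarrow> 0" for t
    proof (cases "t \<in> U")
      case True
      have "(\<lambda>n. X n + t) \<longlonglongrightarrow> 0 + t" by (intro tendsto_intros X)
      then have "eventually (\<lambda>n. X n + t \<in> U) sequentially"
        using topological_tendstoD[OF _ U(1)] True by force
      then have "eventually (\<lambda>n. 0 = ?p n t) sequentially"
        by eventually_elim (simp add: True)
      then show ?thesis by (rule Lim_transform_eventually[OF tendsto_const])
    qed simp
    then show "AE t in lborel. (\<lambda>n. ?p n t) \<longlonglongrightarrow> 0" by simp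
    show "AE t in lborel. norm (?p n t) \<le> indicator U t" for n
      by (auto split: split_indicator)
  qed measurable
  moreover have "(LINT t|lborel. \<bar>indicator U (X n + t) - indicator U t :: real\<bar>) = 2 * (LINT t|lborel. ?p n t)" for n
  proof -
    have int': "integrable lborel (\<lambda>t. indicator U (X n + t) :: real)"
      by (rule integrable_translate[OF int])
    \<comment> \<open>With \<open>p\<close> the positive part of \<open>a\<close>, \<open>\<bar>a\<bar> = 2 * p - a\<close>; here \<open>a\<close> has integral \<open>0\<close>.\<close>
    have "(LINT t|lborel. \<bar>indicator U (X n + t) - indicator U t :: real\<bar>) =
        (LINT t|lborel. 2 * ?p n t - (indicator U t - indicator U (X n + t)))"
      by (intro Bochner_Integration.integral_cong) (auto split: split_indicator)
    also have "\<dots> = 2 * (LINT t|lborel. ?p n t) -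
        ((LINT t|lborel. indicator U t) - (LINT t|lborel. indicator U (X n + t)))"
      using int int' by (subst Bochner_Integration.integral_diff) (auto intro!: integrable_max)
    also have "(LINT t|lborel. indicator U (X n + t) :: real) = (LINT t|lborel. indicator U t)"
      by (rule integral_translate[where f="indicator U"]) measurable
    finally show ?thesis by simp
  qed
  ultimately show "(\<lambda>n. LINT t|lborel. \<bar>indicator U (X n + t) - indicator U t :: real\<bar>) \<longlonglongrightarrow> 0"
    using tendsto_mult_right_zero[of _ _ 2] by simp
qed

lemma L1_translation_continuous_cmult:
  assumes "L1_translation_continuous h"
  shows "L1_translation_continuous (\<lambda>x. h x * c)"
proof -
  have "(LINT t|lborel. \<bar>h (x + t) * c - h t * c\<bar>) = (LINT t|lborel. \<bar>h (x + t) - h t\<bar>) * \<bar>c\<bar>" for x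
    by (subst integral_mult_left_zero[symmetric]) (simp add: abs_mult[symmetric] left_diff_distrib)
  with assms show ?thesis
    by (auto simp: L1_translation_continuous_def intro!: tendsto_mult_left_zero)
qed

text \<open>
  Outer regularity passes from open sets to Borel sets of finite measure; sums and dominated limits
  then give every integrable function.
\<close>
lemma L1_translation_continuous:
  fixes h :: "'a::euclidean_space \<Rightarrow> real"
  assumes "integrable lborel h"
  shows "L1_translation_continuous h"
  using assms
proof induct
  case (base A c)
  have [measurable]: "A \<in> sets borel" using base by simp
  have intA: "integrable lborel (indicator A :: 'a \<Rightarrow> real)"
    using base by (intro integrable_real_indicator) auto
  have "L1_translation_continuous (indicator A :: 'a \<Rightarrow> real)"
  proof (rule L1_translation_continuous_approx[OF intA])
    fix e :: real assume e: "0 < e"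
    obtain U where U: "open U" "A \<subseteq> U" "emeasure lborel (U - A) < ennreal e"
      using outer_regular_lborel[of A e] e by auto
    have [measurable]: "U \<in> sets borel" using U by simp
    have "emeasure lborel U = emeasure lborel A + emeasure lborel (U - A)"
      using U(2) by (subst plus_emeasure) (auto simp: Un_absorb1)
    then have fin: "emeasure lborel U < \<infinity>"
      using base U(3) by (auto simp: ennreal_add_eq_top top.not_eq_extremum intro: less_trans)
    have "(LINT t|lborel. \<bar>indicator A t - indicator U t :: real\<bar>) = (LINT t|lborel. indicator (U - A) t)"
      using U(2) by (intro Bochner_Integration.integral_cong) (auto split: split_indicator)
    also have "\<dots> = measure lborel (U - A)" by simp
    also have "\<dots> \<le> e"
      using U(3) e unfolding measure_def by (intro enn2real_leI) auto
    finally show "\<exists>k. integrable lborel k \<and> L1_translation_continuous k \<and>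
        (LINT t|lborel. \<bar>indicator A t - k t\<bar>) \<le> e"
      using U(1) fin by (intro exI[of _ "indicator U"])
        (auto intro!: integrable_real_indicator L1_translation_continuous_indicator_open)
  qed
  then show ?case using L1_translation_continuous_cmult by fastforce
next
  case (add f g)
  have [measurable]: "f \<in> borel_measurable borel" "g \<in> borel_measurable borel" using add by auto
  show ?case
    unfolding L1_translation_continuous_def
  proof (intro allI impI)
    fix X :: "nat \<Rightarrow> 'a" assume X: "X \<longlonglongrightarrow> 0"
    note int = integrable_translate[OF add(1)] integrable_translate[OF add(3)] add(1,3)
    let ?r = "\<lambda>n. (LINT t|lborel. \<bar>f (X n + t) - f t\<bar>) + (LINT t|lborel. \<bar>g (X n + t) - g t\<bar>)"
    have lim: "?r \<longlonglongrightarrow> 0"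
      using add(2,4) X by (auto simp: L1_translation_continuous_def intro!: tendsto_add_zero)
    have le: "(LINT t|lborel. \<bar>f (X n + t) + g (X n + t) - (f t + g t)\<bar>) \<le> ?r n" for n
    proof -
      have "?r n = (LINT t|lborel. \<bar>f (X n + t) - f t\<bar> + \<bar>g (X n + t) - g t\<bar>)"
        using int by (subst Bochner_Integration.integral_add) auto
      moreover have "(LINT t|lborel. \<bar>f (X n + t) + g (X n + t) - (f t + g t)\<bar>) \<le> \<dots>"
        using int by (intro integral_mono integrable_abs Bochner_Integration.integrable_add
            Bochner_Integration.integrable_diff) auto
      ultimately show ?thesis by simp
    qed
    show "(\<lambda>n. LINT t|lborel. \<bar>f (X n + t) + g (X n + t) - (f t + g t)\<bar>) \<longlonglongrightarrow> 0"
      by (rule real_tendsto_sandwich[OF _ _ tendsto_const lim]) (auto intro!: always_eventually le)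
  qed
next
  case (lim f s)
  have [measurable]: "f \<in> borel_measurable borel" "\<And>i. s i \<in> borel_measurable borel" using lim(1,5) by auto
  show ?case
  proof (rule L1_translation_continuous_approx[OF lim(5)])
    fix e :: real assume e: "0 < e"
    have "(\<lambda>i. LINT t|lborel. \<bar>f t - s i t\<bar>) \<longlonglongrightarrow> (LINT t|(lborel :: 'a measure). (0::real))"
    proof (rule integral_dominated_convergence[where w="\<lambda>t. 3 * \<bar>f t\<bar>"])
      have "(\<lambda>i. \<bar>f t - s i t\<bar>) \<longlonglongrightarrow> \<bar>f t - f t\<bar>" for t
        using lim(3)[of t] by (intro tendsto_intros) auto
      then show "AE t in lborel. (\<lambda>i. \<bar>f t - s i t\<bar>) \<longlonglongrightarrow> 0" by simp
      have "\<bar>f t - s i t\<bar> \<le> 3 * \<bar>f t\<bar>" for i t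
        using lim(4)[of t i] by (simp add: abs_if split: if_splits)
      then show "AE t in lborel. norm \<bar>f t - s i t\<bar> \<le> 3 * \<bar>f t\<bar>" for i by simp
    qed (use lim(5) in \<open>auto\<close>)
    then have "eventually (\<lambda>i. (LINT t|lborel. \<bar>f t - s i t\<bar>) < e) sequentially"
      using e by (intro order_tendstoD) simp_all
    then obtain i where "(LINT t|lborel. \<bar>f t - s i t\<bar>) < e"
      by (auto simp: eventually_sequentially)
    with lim(1,2) show "\<exists>k. integrable lborel k \<and> L1_translation_continuous k \<and>
        (LINT t|lborel. \<bar>f t - k t\<bar>) \<le> e"
      by (intro exI[of _ "s i"]) auto
  qed
qed

text \<open>
  With \<open>r \<mapsto> r * \<bar>r\<bar>\<close> a real square-integrable function becomes an integrable one without losing its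
  sign.  This inequality bounds differences in \<open>L\<^sup>2\<close> by differences in \<open>L\<^sup>1\<close>.
\<close>
lemma square_diff_le_signed_squares:
  fixes r s :: real
  shows "(r - s)\<^sup>2 \<le> 2 * \<bar>r * \<bar>r\<bar> - s * \<bar>s\<bar>\<bar>"
proof -
  have *: "(a - b)\<^sup>2 \<le> 2 * \<bar>a * \<bar>a\<bar> - b * \<bar>b\<bar>\<bar>" if "b \<le> a" for a b :: real
  proof (cases "0 \<le> b \<or> a \<le> 0")
    case True
    then have "(a - b) * (a - b) \<le> (a - b) * (\<bar>a\<bar> + \<bar>b\<bar>)"
      using that by (intro mult_left_mono) auto
    also have "\<dots> = \<bar>a * \<bar>a\<bar> - b * \<bar>b\<bar>\<bar>"
    proof (cases "0 \<le> b")
      case True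
      then have "b * b \<le> a * a" using that by (intro mult_mono) auto
      then show ?thesis using True that by (simp add: algebra_simps)
    next
      case False
      then have "a \<le> 0" "b < 0" using True by auto
      then have "a * a \<le> b * b" using that mult_mono[of "-a" "-b" "-a" "-b"] by auto
      then show ?thesis using \<open>a \<le> 0\<close> \<open>b < 0\<close> by (simp add: algebra_simps)
    qed
    finally show ?thesis by (simp add: power2_eq_square)
        (metis abs_ge_zero mult_2 add_increasing2 order_trans)
  next
    case False
    then have ab: "0 < a" "b < 0" by auto
    have "0 \<le> (a + b)\<^sup>2" by simp
    then have "(a - b)\<^sup>2 \<le> 2 * (a * a + b * b)" by (simp add: power2_eq_square algebra_simps)
    also have "a * a + b * b = \<bar>a * \<bar>a\<bar> - b * \<bar>b\<bar>\<bar>" using ab by (simp add: add_nonneg_nonneg)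
    finally show ?thesis .
  qed
  show ?thesis
  proof (cases "s \<le> r")
    case False
    then show ?thesis using *[of r s] by (simp add: power2_commute abs_minus_commute)
  qed (rule *)
qed

lemma L2_translation_continuous:
  fixes g :: "'a::euclidean_space \<Rightarrow> complex"
  assumes g: "square_integrable g" and X: "X \<longlonglongrightarrow> 0"
  shows "(\<lambda>n. LINT t|lborel. (norm (g (X n + t) - g t))\<^sup>2) \<longlonglongrightarrow> 0"
proof -
  have [measurable]: "g \<in> borel_measurable borel" using g by (auto simp: square_integrable_def)
  have norm_int: "integrable lborel (\<lambda>x. (norm (g x))\<^sup>2)"
    using g by (simp add: square_integrable_def)
  \<comment> \<open>Signed squares of the real and imaginary parts, which are integrable.\<close>
  let ?R = "\<lambda>t. Re (g t) * \<bar>Re (g t)\<bar>" and ?I = "\<lambda>t. Im (g t) * \<bar>Im (g t)\<bar>"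
  have R: "integrable lborel ?R"
    by (rule Bochner_Integration.integrable_bound[OF norm_int])
       (auto simp: abs_mult cmod_power2 simp flip: power2_eq_square)
  have I: "integrable lborel ?I"
    by (rule Bochner_Integration.integrable_bound[OF norm_int])
       (auto simp: abs_mult cmod_power2 simp flip: power2_eq_square)
  note int = R I integrable_translate[OF R] integrable_translate[OF I]
  let ?r = "\<lambda>n. 2 * (LINT t|lborel. \<bar>?R (X n + t) - ?R t\<bar>) + 2 * (LINT t|lborel. \<bar>?I (X n + t) - ?I t\<bar>)"
  have lim: "?r \<longlonglongrightarrow> 0"
    using L1_translation_continuous[OF R] L1_translation_continuous[OF I] X
    unfolding L1_translation_continuous_def
    by (intro tendsto_add_zero tendsto_mult_right_zero) auto
  have le: "(LINT t|lborel. (norm (g (X n + t) - g t))\<^sup>2) \<le> ?r n" for n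
  proof -
    have "(LINT t|lborel. (norm (g (X n + t) - g t))\<^sup>2) \<le>
        (LINT t|lborel. 2 * \<bar>?R (X n + t) - ?R t\<bar> + 2 * \<bar>?I (X n + t) - ?I t\<bar>)"
    proof (rule integral_mono')
      show "integrable lborel (\<lambda>t. 2 * \<bar>?R (X n + t) - ?R t\<bar> + 2 * \<bar>?I (X n + t) - ?I t\<bar>)"
        using int by (intro Bochner_Integration.integrable_add integrable_mult_right integrable_abs
          Bochner_Integration.integrable_diff) auto
      show "(norm (g (X n + t) - g t))\<^sup>2 \<le> 2 * \<bar>?R (X n + t) - ?R t\<bar> + 2 * \<bar>?I (X n + t) - ?I t\<bar>" for t
        unfolding cmod_power2 using square_diff_le_signed_squares by (simp add: add_mono)
    qed auto
    also have "\<dots> = ?r n"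
      using int by (subst Bochner_Integration.integral_add) auto
    finally show ?thesis .
  qed
  show ?thesis
    by (rule real_tendsto_sandwich[OF _ _ tendsto_const lim]) (auto intro!: always_eventually le)
qed

section \<open>Products of square-integrable functions\<close>

lemma square_integrable_borel_measurable [measurable_dest]:
  "square_integrable f \<Longrightarrow> f \<in> borel_measurable borel"
  by (simp add: square_integrable_def)

lemma square_integrable_cnj: "square_integrable g \<Longrightarrow> square_integrable (\<lambda>t. cnj (g t))"
  by (auto simp: square_integrable_def)

lemma square_integrable_translate:
  assumes "square_integrable g" shows "square_integrable (\<lambda>t. g (x + t))"
proof -
  have [measurable]: "g \<in> borel_measurable borel" using assms by auto
  show ?thesis
    using assms integrable_translate[of "\<lambda>t. (norm (g t))\<^sup>2" x]
    by (simp add: square_integrable_def)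
qed

lemma integrable_mult_square_integrable:
  assumes f: "square_integrable f" and g: "square_integrable g"
  shows "integrable lborel (\<lambda>t. f t * g t)"
proof (rule Bochner_Integration.integrable_bound)
  have [measurable]: "f \<in> borel_measurable borel" "g \<in> borel_measurable borel" using f g by auto
  show "integrable lborel (\<lambda>x. (norm (f x))\<^sup>2 + (norm (g x))\<^sup>2)"
    using f g by (auto simp: square_integrable_def)
  show "(\<lambda>t. f t * g t) \<in> borel_measurable lborel" by measurable
  have "norm (a * b) \<le> norm ((norm a)\<^sup>2 + (norm b)\<^sup>2)" for a b :: complex
    using sum_squares_bound[of "norm a" "norm b"] mult_nonneg_nonneg[OF norm_ge_zero norm_ge_zero, of a b]
    by (simp add: norm_mult, linarith)
  then show "AE x in lborel. norm (f x * g x) \<le> norm ((norm (f x))\<^sup>2 + (norm (g x))\<^sup>2)" by simp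
qed

text \<open>
  The Cauchy-Schwarz inequality for complex-valued functions.
\<close>
lemma norm_integral_mult_le:
  assumes f: "square_integrable f" and g: "square_integrable g"
  shows "norm (LINT t|lborel. f t * g t) \<le>
           sqrt (LINT t|lborel. (norm (f t))\<^sup>2) * sqrt (LINT t|lborel. (norm (g t))\<^sup>2)"
proof -
  have [measurable]: "f \<in> borel_measurable borel" "g \<in> borel_measurable borel" using f g by auto
  have int: "integrable lborel (\<lambda>t. norm (f t) * norm (g t))"
    using integrable_norm[OF integrable_mult_square_integrable[OF f g]] by (simp add: norm_mult)
  have f2: "integrable lborel (\<lambda>x. (norm (f x))\<^sup>2)" and g2: "integrable lborel (\<lambda>x. (norm (g x))\<^sup>2)"
    using f g by (auto simp: square_integrable_def)
  let ?I = "LINT t|lborel. norm (f t) * norm (g t)"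
  have "(ennreal ?I)\<^sup>2 = (\<integral>\<^sup>+t. ennreal (norm (f t)) * ennreal (norm (g t)) \<partial>lborel)\<^sup>2"
    by (subst nn_integral_eq_integral[OF int, symmetric]) (auto simp: ennreal_mult)
  also have "\<dots> \<le> (\<integral>\<^sup>+t. (ennreal (norm (f t)))\<^sup>2 \<partial>lborel) * (\<integral>\<^sup>+t. (ennreal (norm (g t)))\<^sup>2 \<partial>lborel)"
    by (rule Cauchy_Schwarz_nn_integral) measurable
  also have "\<dots> = ennreal (LINT t|lborel. (norm (f t))\<^sup>2) * ennreal (LINT t|lborel. (norm (g t))\<^sup>2)"
    using nn_integral_eq_integral[OF f2] nn_integral_eq_integral[OF g2] by (simp add: ennreal_power)
  finally have "ennreal (?I\<^sup>2) \<le> ennreal ((LINT t|lborel. (norm (f t))\<^sup>2) * (LINT t|lborel. (norm (g t))\<^sup>2))"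
    by (simp add: ennreal_power ennreal_mult)
  then have "?I\<^sup>2 \<le> (LINT t|lborel. (norm (f t))\<^sup>2) * (LINT t|lborel. (norm (g t))\<^sup>2)"
    by (subst (asm) ennreal_le_iff) auto
  then have "?I \<le> sqrt ((LINT t|lborel. (norm (f t))\<^sup>2) * (LINT t|lborel. (norm (g t))\<^sup>2))"
    by (rule real_le_rsqrt)
  moreover have "norm (LINT t|lborel. f t * g t) \<le> ?I"
    using integral_norm_bound[of lborel "\<lambda>t. f t * g t"] by (simp add: norm_mult)
  ultimately show ?thesis by (simp add: real_sqrt_mult)
qed

section \<open>The Fourier integral\<close>

definition fourier :: "('a::euclidean_space \<Rightarrow> complex) \<Rightarrow> 'a \<Rightarrow> complex" where
  "fourier F \<omega> = (LINT t|lborel. F t * exp (- 2 * pi * \<i> * (\<omega> \<bullet> t)))"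

lemma norm_character [simp]: "norm (exp (- 2 * pi * \<i> * of_real r)) = 1"
  by (simp add: norm_exp_eq_Re)

text \<open>
  The same fact for the simplifier normal form of the exponent.
\<close>
lemma norm_character' [simp]: "norm (exp (- (2 * complex_of_real pi * \<i> * complex_of_real r))) = 1"
  by (simp add: norm_exp_eq_Re)

lemma measurable_fourier [measurable]:
  fixes F :: "'a::euclidean_space \<Rightarrow> complex"
  assumes [measurable]: "F \<in> borel_measurable borel"
  shows "fourier F \<in> borel_measurable borel"
proof -
  have "(\<lambda>\<omega>. LINT t|lborel. F t * exp (- 2 * pi * \<i> * (\<omega> \<bullet> t))) \<in> borel_measurable borel"
    by measurable
  then show ?thesis by (simp add: fourier_def[abs_def])
qed

lemma integrable_fourier_integrand:
  fixes F :: "'a::euclidean_space \<Rightarrow> complex"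
  assumes "integrable lborel F"
  shows "integrable lborel (\<lambda>t. F t * exp (- 2 * pi * \<i> * (\<omega> \<bullet> t)))"
proof (rule Bochner_Integration.integrable_bound[OF assms])
  have [measurable]: "F \<in> borel_measurable borel" using assms by auto
  show "(\<lambda>t. F t * exp (- 2 * pi * \<i> * (\<omega> \<bullet> t))) \<in> borel_measurable lborel" by measurable
qed (simp add: norm_mult)

lemma norm_fourier_le:
  fixes F :: "'a::euclidean_space \<Rightarrow> complex"
  shows "norm (fourier F \<omega>) \<le> (LINT t|lborel. norm (F t))"
  unfolding fourier_def
  using integral_norm_bound[of lborel "\<lambda>t. F t * exp (- 2 * pi * \<i> * (\<omega> \<bullet> t))"]
  by (simp add: norm_mult)

text \<open>
  Fubini's theorem applied to \<open>F(t) H(\<omega>) exp (- 2\<pi>i \<omega>\<cdot>t)\<close>, which is integrable on the product.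
\<close>
lemma fourier_multiplication_formula:
  fixes F H :: "'a::euclidean_space \<Rightarrow> complex"
  assumes F: "integrable lborel F" and H: "integrable lborel H"
  shows "(LINT \<omega>|lborel. fourier F \<omega> * H \<omega>) = (LINT t|lborel. F t * fourier H t)"
proof -
  have [measurable]: "F \<in> borel_measurable borel" "H \<in> borel_measurable borel" using F H by auto
  let ?h = "\<lambda>(\<omega>, t). F t * exp (- 2 * pi * \<i> * (\<omega> \<bullet> t)) * H \<omega>"
  have "integrable (lborel \<Otimes>\<^sub>M lborel) ?h"
  proof (rule lborel_pair.Fubini_integrable)
    show "?h \<in> borel_measurable (lborel \<Otimes>\<^sub>M lborel)" by measurable
    show "integrable lborel (\<lambda>x. LINT y|lborel. norm (?h (x, y)))"
      using H by (simp add: norm_mult)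
    show "AE x in lborel. integrable lborel (\<lambda>y. ?h (x, y))"
      using integrable_fourier_integrand[OF F] by simp
  qed
  then have swap: "(LINT t|lborel. LINT \<omega>|lborel. F t * exp (- 2 * pi * \<i> * (\<omega> \<bullet> t)) * H \<omega>) =
      (LINT \<omega>|lborel. LINT t|lborel. F t * exp (- 2 * pi * \<i> * (\<omega> \<bullet> t)) * H \<omega>)"
    by (rule lborel_pair.Fubini_integral)
  have inner: "(LINT \<omega>|lborel. F t * exp (- 2 * pi * \<i> * (\<omega> \<bullet> t)) * H \<omega>) = F t * fourier H t" for t
  proof -
    have "(LINT \<omega>|lborel. F t * exp (- 2 * pi * \<i> * (\<omega> \<bullet> t)) * H \<omega>) =
        (LINT \<omega>|lborel. F t * (H \<omega> * exp (- 2 * pi * \<i> * (t \<bullet> \<omega>))))"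
      by (intro Bochner_Integration.integral_cong refl) (simp only: inner_commute mult_ac)
    then show ?thesis by (simp add: fourier_def)
  qed
  show ?thesis
    using swap unfolding inner by (simp add: fourier_def)
qed

section \<open>The Gaussian and its Fourier transform\<close>

definition gauss :: "'a::euclidean_space \<Rightarrow> real" where
  "gauss x = exp (- (norm x)\<^sup>2 / 2)"

lemma measurable_gauss [measurable]: "gauss \<in> borel_measurable borel"
  unfolding gauss_def[abs_def] by measurable

lemma gauss_eq_prod: "gauss x = (\<Prod>b\<in>Basis. exp (- (x \<bullet> b)\<^sup>2 / 2))"
proof -
  have "(norm x)\<^sup>2 = (\<Sum>b\<in>Basis. (x \<bullet> b)\<^sup>2)"
    unfolding power2_norm_eq_inner by (subst euclidean_inner) (simp add: power2_eq_square)
  then have "- (norm x)\<^sup>2 / 2 = (\<Sum>b\<in>Basis. - (x \<bullet> b)\<^sup>2 / 2)"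
    by (simp add: sum_negf sum_divide_distrib)
  then show ?thesis
    unfolding gauss_def by (simp only: exp_sum finite_Basis)
qed

text \<open>
  Lebesgue measure on a Euclidean space is the image of a product measure indexed by the basis, so
  integrals of products of functions of one coordinate factor.
\<close>
lemma integral_prod_Basis:
  fixes \<phi> :: "'a::euclidean_space \<Rightarrow> real \<Rightarrow> complex"
  assumes "\<And>b. b \<in> Basis \<Longrightarrow> integrable lborel (\<phi> b)"
  shows "(LINT x|lborel. (\<Prod>b\<in>Basis. \<phi> b (x \<bullet> b))) = (\<Prod>b\<in>Basis. LINT t|lborel. \<phi> b t)"
proof -
  interpret product_sigma_finite "\<lambda>_::'a. lborel :: real measure" ..
  have [measurable]: "b \<in> Basis \<Longrightarrow> \<phi> b \<in> borel_measurable borel" for b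
    using assms[of b] by auto
  have "(LINT x|lborel. (\<Prod>b\<in>Basis. \<phi> b (x \<bullet> b))) =
      (LINT f|(\<Pi>\<^sub>M b\<in>Basis. lborel). (\<Prod>b\<in>Basis. \<phi> b ((\<Sum>b\<in>Basis. f b *\<^sub>R b) \<bullet> b)))"
    by (subst lborel_eq) (simp add: integral_distr)
  also have "\<dots> = (LINT f|(\<Pi>\<^sub>M b\<in>Basis. lborel). (\<Prod>b\<in>Basis. \<phi> b (f b)))"
    by (simp cong: prod.cong)
  also have "\<dots> = (\<Prod>b\<in>Basis. LINT t|lborel. \<phi> b t)"
    by (rule product_integral_prod) (use assms in auto)
  finally show ?thesis .
qed

lemma integrable_gauss_1: "integrable lborel (\<lambda>t::real. exp (- t\<^sup>2 / 2))"
proof -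
  have "integrable lborel std_normal_density" by simp
  then have "integrable lborel (\<lambda>t::real. sqrt (2 * pi) * std_normal_density t)" by simp
  then show ?thesis by (simp add: std_normal_density_def)
qed

text \<open>
  Up to normalisation this is the characteristic function of the standard normal distribution.
\<close>
lemma integral_gauss_1:
  "(LINT t|lborel. complex_of_real (exp (- t\<^sup>2 / 2)) * exp (\<i> * of_real (s * t))) =
     complex_of_real (sqrt (2 * pi) * exp (- s\<^sup>2 / 2))"
proof -
  have "complex_of_real (exp (- s\<^sup>2 / 2)) = (LINT t|density lborel std_normal_density. iexp (s * t))"
    using char_std_normal_distribution by (metis char_def)
  also have "\<dots> = (LINT t|lborel. std_normal_density t *\<^sub>R iexp (s * t))"
    by (rule integral_density) (auto simp: normal_density_nonneg)
  also have "\<dots> = (LINT t|lborel. complex_of_real (1 / sqrt (2 * pi)) *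
      (complex_of_real (exp (- t\<^sup>2 / 2)) * exp (\<i> * of_real (s * t))))"
    by (simp add: std_normal_density_def scaleR_conv_of_real mult.assoc)
  also have "\<dots> = complex_of_real (1 / sqrt (2 * pi)) *
      (LINT t|lborel. complex_of_real (exp (- t\<^sup>2 / 2)) * exp (\<i> * of_real (s * t)))"
    by (rule integral_mult_right_zero)
  finally show ?thesis by (simp add: field_simps)
qed

lemma integrable_gauss: "integrable lborel (gauss :: 'a::euclidean_space \<Rightarrow> real)"
proof (rule integrableI_bounded)
  have "(\<integral>\<^sup>+x. ennreal (norm (gauss (x::'a))) \<partial>lborel) =
      (\<integral>\<^sup>+x. (\<Prod>b\<in>Basis. ennreal (exp (- ((x::'a) \<bullet> b)\<^sup>2 / 2))) \<partial>lborel)"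
    by (simp add: gauss_eq_prod prod_ennreal prod_nonneg)
  also have "\<dots> = (\<Prod>b\<in>(Basis::'a set). \<integral>\<^sup>+t. ennreal (exp (- t\<^sup>2 / 2)) \<partial>lborel)"
    by (rule nn_integral_lborel_prod) auto
  also have "\<dots> < \<infinity>"
    using integrable_gauss_1 unfolding integrable_iff_bounded
    by (simp add: ennreal_prod_eq_top less_top power_less_top_ennreal)
  finally show "(\<integral>\<^sup>+x. ennreal (norm (gauss (x::'a))) \<partial>lborel) < \<infinity>" .
qed simp

lemma fourier_gauss:
  fixes u :: "'a::euclidean_space"
  shows "fourier (\<lambda>x. complex_of_real (gauss x)) u =
           complex_of_real (sqrt (2 * pi) ^ DIM('a) * gauss ((2 * pi) *\<^sub>R u))"
proof -
  let ?\<phi> = "\<lambda>b t. complex_of_real (exp (- t\<^sup>2 / 2)) * exp (\<i> * of_real ((- 2 * pi * (u \<bullet> b)) * t))"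
  have int: "integrable lborel (?\<phi> b)" for b
  proof (rule Bochner_Integration.integrable_bound[OF integrable_gauss_1])
    show "?\<phi> b \<in> borel_measurable lborel" by measurable
  qed (simp add: norm_mult norm_exp_eq_Re)
  have "complex_of_real (gauss x) * exp (- 2 * pi * \<i> * (u \<bullet> x)) = (\<Prod>b\<in>Basis. ?\<phi> b (x \<bullet> b))" for x
  proof -
    have "- 2 * pi * \<i> * complex_of_real (u \<bullet> x) =
        (\<Sum>b\<in>Basis. \<i> * of_real ((- 2 * pi * (u \<bullet> b)) * (x \<bullet> b)))"
      by (subst euclidean_inner) (simp add: sum_distrib_left mult.assoc sum_negf mult.left_commute)
    then show ?thesis
      by (simp only: exp_sum finite_Basis gauss_eq_prod of_real_prod prod.distrib)
  qed
  then have "fourier (\<lambda>x. complex_of_real (gauss x)) u = (LINT x|lborel. (\<Prod>b\<in>Basis. ?\<phi> b (x \<bullet> b)))"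
    by (simp add: fourier_def)
  also have "\<dots> = (\<Prod>b\<in>Basis. LINT t|lborel. ?\<phi> b t)"
    by (rule integral_prod_Basis) (rule int)
  also have "\<dots> = (\<Prod>b\<in>(Basis::'a set). complex_of_real (sqrt (2 * pi) * exp (- (- 2 * pi * (u \<bullet> b))\<^sup>2 / 2)))"
    by (simp only: integral_gauss_1)
  also have "\<dots> = complex_of_real (sqrt (2 * pi) ^ DIM('a) * gauss ((2 * pi) *\<^sub>R u))"
    by (simp add: gauss_eq_prod prod.distrib)
  finally show ?thesis .
qed

text \<open>
  The Fourier transform of the Gaussian.  Its dilates \<open>r\<^sup>d gauss_kernel (r v)\<close>, where \<open>d\<close> is the dimension,
  form an approximate identity as \<open>r\<close> grows.
\<close>
definition gauss_kernel :: "'a::euclidean_space \<Rightarrow> real" where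
  "gauss_kernel v = sqrt (2 * pi) ^ DIM('a) * gauss ((2 * pi) *\<^sub>R v)"

lemma gauss_kernel_nonneg: "0 \<le> gauss_kernel v"
  by (simp add: gauss_kernel_def gauss_def)

lemma measurable_gauss_kernel [measurable]: "gauss_kernel \<in> borel_measurable borel"
  unfolding gauss_kernel_def[abs_def] by measurable

lemma integrable_gauss_kernel: "integrable lborel (gauss_kernel :: 'a::euclidean_space \<Rightarrow> real)"
  unfolding gauss_kernel_def[abs_def]
  by (intro integrable_mult_right integrable_scaleR_arg integrable_gauss) auto

text \<open>
  The mass of the Gaussian itself is the value of its Fourier transform at \<open>0\<close>.
\<close>
lemma integral_gauss_kernel: "(LINT v|lborel. gauss_kernel (v::'a::euclidean_space)) = 1"
proof -
  have "complex_of_real (LINT x|lborel. gauss (x::'a)) = fourier (\<lambda>x. complex_of_real (gauss x)) (0::'a)"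
    by (simp add: fourier_def)
  also have "\<dots> = complex_of_real (sqrt (2 * pi) ^ DIM('a))"
    unfolding fourier_gauss by (simp add: gauss_def)
  finally have g: "(LINT x|lborel. gauss (x::'a)) = sqrt (2 * pi) ^ DIM('a)"
    by (simp only: of_real_eq_iff)
  have "sqrt (2 * pi) ^ DIM('a) = (2 * pi) ^ DIM('a) * (LINT v|lborel. gauss ((2 * pi) *\<^sub>R (v::'a)))"
    using integral_scaleR_arg[of "gauss :: 'a \<Rightarrow> real" "2 * pi"] g by simp
  also have "(2 * pi) ^ DIM('a) = sqrt (2 * pi) ^ DIM('a) * sqrt (2 * pi) ^ DIM('a)"
    by (simp only: power_mult_distrib[symmetric] real_sqrt_mult_self) simp
  finally have "sqrt (2 * pi) ^ DIM('a) * (LINT v|lborel. gauss ((2 * pi) *\<^sub>R (v::'a))) = 1"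
    by simp
  then show ?thesis by (simp add: gauss_kernel_def)
qed

section \<open>The Plancherel identity\<close>

definition autocorrelation :: "('a::euclidean_space \<Rightarrow> complex) \<Rightarrow> 'a \<Rightarrow> complex" where
  "autocorrelation F u = (LINT t|lborel. F t * cnj (F (u + t)))"

lemma measurable_autocorrelation [measurable]:
  fixes F :: "'a::euclidean_space \<Rightarrow> complex"
  assumes [measurable]: "F \<in> borel_measurable borel"
  shows "autocorrelation F \<in> borel_measurable borel"
proof -
  have "(\<lambda>u. LINT t|lborel. F t * cnj (F (u + t))) \<in> borel_measurable borel" by measurable
  then show ?thesis by (simp add: autocorrelation_def[abs_def])
qed

lemma integral_norm_translate:
  fixes F :: "'a::euclidean_space \<Rightarrow> complex"
  assumes "square_integrable F"
  shows "(LINT t|lborel. (norm (F (u + t)))\<^sup>2) = (LINT t|lborel. (norm (F t))\<^sup>2)"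
proof -
  have [measurable]: "F \<in> borel_measurable borel" using assms by auto
  show ?thesis by (rule integral_translate[where f="\<lambda>t. (norm (F t))\<^sup>2"]) measurable
qed

lemma norm_autocorrelation_le:
  assumes F: "square_integrable F"
  shows "norm (autocorrelation F u) \<le> (LINT t|lborel. (norm (F t))\<^sup>2)"
  using norm_integral_mult_le[OF F square_integrable_cnj[OF square_integrable_translate[OF F, of u]]]
  by (simp add: autocorrelation_def integral_norm_translate[OF F])

text \<open>
  By Cauchy-Schwarz, continuity at \<open>0\<close> reduces to that of translations in mean square.
\<close>
lemma autocorrelation_tendsto:
  assumes F: "square_integrable F" and X: "X \<longlonglongrightarrow> 0"
  shows "(\<lambda>n. autocorrelation F (X n)) \<longlonglongrightarrow> complex_of_real (LINT t|lborel. (norm (F t))\<^sup>2)"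
proof -
  let ?N = "LINT t|lborel. (norm (F t))\<^sup>2"
  let ?d = "\<lambda>n. sqrt ?N * sqrt (LINT t|lborel. (norm (F (X n + t) - F t))\<^sup>2)"
  have lim: "?d \<longlonglongrightarrow> 0"
    using tendsto_mult_right_zero[OF tendsto_real_sqrt[OF L2_translation_continuous[OF F X], simplified]] .
  have le: "norm (autocorrelation F (X n) - of_real ?N) \<le> ?d n" for n
  proof -
    note Fn = square_integrable_translate[OF F, of "X n"]
    have N: "complex_of_real ?N = (LINT t|lborel. F t * cnj (F t))"
      by (simp add: complex_norm_square[symmetric] del: of_real_power)
    have "autocorrelation F (X n) - of_real ?N = (LINT t|lborel. F t * cnj (F (X n + t) - F t))"
      unfolding autocorrelation_def N using F Fn
      by (simp add: right_diff_distrib integrable_mult_square_integrable square_integrable_cnj)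
    then show ?thesis
      using norm_integral_mult_le[OF F square_integrable_cnj[OF square_integrable_diff[OF Fn F]]]
      by (simp flip: complex_cnj_diff)
  qed
  have "(\<lambda>n. norm (autocorrelation F (X n) - of_real ?N)) \<longlonglongrightarrow> 0"
    by (rule real_tendsto_sandwich[OF _ _ tendsto_const lim]) (auto intro!: always_eventually le)
  then show ?thesis by (simp add: tendsto_norm_zero_iff LIM_zero_cancel)
qed

lemma fourier_modulated_gauss:
  fixes s t :: "'a::euclidean_space"
  assumes r: "0 < r"
  shows "fourier (\<lambda>\<omega>. of_real (gauss (\<omega> /\<^sub>R r)) * cnj (exp (- 2 * pi * \<i> * (t \<bullet> \<omega>)))) s =
           of_real (r ^ DIM('a) * gauss_kernel (r *\<^sub>R (s - t)))"
proof -
  let ?f = "\<lambda>\<omega>. complex_of_real (gauss (\<omega> /\<^sub>R r)) * exp (- 2 * pi * \<i> * ((s - t) \<bullet> \<omega>))"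
  have "cnj (exp (- 2 * pi * \<i> * (t \<bullet> \<omega>))) * exp (- 2 * pi * \<i> * (s \<bullet> \<omega>)) =
        exp (- 2 * pi * \<i> * ((s - t) \<bullet> \<omega>))" for \<omega>
    by (simp add: exp_cnj exp_add[symmetric] inner_diff_left algebra_simps)
  then have "fourier (\<lambda>\<omega>. of_real (gauss (\<omega> /\<^sub>R r)) * cnj (exp (- 2 * pi * \<i> * (t \<bullet> \<omega>)))) s =
      (LINT \<omega>|lborel. ?f \<omega>)"
    by (simp add: fourier_def mult.assoc)
  also have "\<dots> = (\<bar>r\<bar> ^ DIM('a)) *\<^sub>R (LINT x|lborel. ?f (r *\<^sub>R x))"
    by (rule integral_scaleR_arg) (use r in auto)
  also have "(LINT x|lborel. ?f (r *\<^sub>R x)) = fourier (\<lambda>x. of_real (gauss x)) (r *\<^sub>R (s - t))"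
    using r by (simp add: fourier_def)
  finally show ?thesis
    using r by (simp add: fourier_gauss gauss_kernel_def scaleR_conv_of_real)
qed

text \<open>
  Truncated Fourier inversion: with the Gaussian cut-off \<open>gauss (\<omega> / r)\<close> the inverse transform of
  \<open>fourier F\<close> at \<open>t\<close> is a smooth average of \<open>F\<close> around \<open>t\<close> at scale \<open>1 / r\<close>.
\<close>
lemma integral_fourier_modulated_gauss:
  fixes F :: "'a::euclidean_space \<Rightarrow> complex"
  assumes F: "integrable lborel F" and r: "0 < r"
  shows "(LINT \<omega>|lborel. fourier F \<omega> * (of_real (gauss (\<omega> /\<^sub>R r)) * cnj (exp (- 2 * pi * \<i> * (t \<bullet> \<omega>))))) =
           (LINT v|lborel. F (v /\<^sub>R r + t) * of_real (gauss_kernel v))"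
proof -
  have [measurable]: "F \<in> borel_measurable borel" using F by auto
  let ?H = "\<lambda>\<omega>. of_real (gauss (\<omega> /\<^sub>R r)) * cnj (exp (- 2 * pi * \<i> * (t \<bullet> \<omega>)))"
  let ?f = "\<lambda>s. F s * of_real (r ^ DIM('a) * gauss_kernel (r *\<^sub>R (s - t)))"
  have H: "integrable lborel ?H"
  proof (rule Bochner_Integration.integrable_bound[OF integrable_scaleR_arg[OF integrable_gauss, of "inverse r"]])
    show "?H \<in> borel_measurable lborel" by measurable
    show "inverse r \<noteq> 0" using r by simp
  qed (simp add: norm_mult)
  have "(LINT \<omega>|lborel. fourier F \<omega> * ?H \<omega>) = (LINT s|lborel. F s * fourier ?H s)"
    by (rule fourier_multiplication_formula[OF F H])
  also have "\<dots> = (LINT s|lborel. ?f s)"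
    by (simp only: fourier_modulated_gauss[OF r])
  also have "\<dots> = (LINT s|lborel. ?f (t + s))"
    by (rule integral_translate[symmetric]) measurable
  also have "\<dots> = (\<bar>inverse r\<bar> ^ DIM('a)) *\<^sub>R (LINT v|lborel. ?f (t + v /\<^sub>R r))"
    by (rule integral_scaleR_arg) (use r in auto)
  also have "\<dots> = (LINT v|lborel. (\<bar>inverse r\<bar> ^ DIM('a)) *\<^sub>R ?f (t + v /\<^sub>R r))"
    by simp
  also have "\<dots> = (LINT v|lborel. F (v /\<^sub>R r + t) * of_real (gauss_kernel v))"
    using r by (intro Bochner_Integration.integral_cong)
      (auto simp: scaleR_conv_of_real field_simps power_inverse)
  finally show ?thesis .
qed

text \<open>
  The power \<open>k = 1\<close> justifies the use of the multiplication formula below, and \<open>k = 2\<close> makes the truncated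
  energy of \<open>fourier F\<close> finite before its total energy is known to be so.
\<close>
lemma integrable_norm_fourier_gauss:
  fixes F :: "'a::euclidean_space \<Rightarrow> complex"
  assumes F: "integrable lborel F" and r: "0 < r"
  shows "integrable lborel (\<lambda>\<omega>. (norm (fourier F \<omega>)) ^ k * gauss (\<omega> /\<^sub>R r))"
proof (rule Bochner_Integration.integrable_bound)
  have [measurable]: "F \<in> borel_measurable borel" using F by auto
  show "integrable lborel (\<lambda>\<omega>::'a. (LINT t|lborel. norm (F t)) ^ k * gauss (\<omega> /\<^sub>R r))"
    using r by (intro integrable_mult_right integrable_scaleR_arg integrable_gauss) auto
  show "(\<lambda>\<omega>. (norm (fourier F \<omega>)) ^ k * gauss (\<omega> /\<^sub>R r)) \<in> borel_measurable lborel" by measurable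
  show "AE \<omega> in lborel. norm ((norm (fourier F \<omega>)) ^ k * gauss (\<omega> /\<^sub>R r)) \<le>
          norm ((LINT t|lborel. norm (F t)) ^ k * gauss (\<omega> /\<^sub>R r))"
    by (auto simp: norm_mult norm_power gauss_def intro!: power_mono norm_fourier_le)
qed

text \<open>
  Writing \<open>|fourier F|\<^sup>2\<close> as \<open>fourier F\<close> times its conjugate and moving the first transform to the
  other factor turns the truncated energy on the frequency side into a weighted mean of the
  autocorrelation of \<open>F\<close>.
\<close>
lemma integral_norm_fourier_gauss:
  fixes F :: "'a::euclidean_space \<Rightarrow> complex"
  assumes F: "integrable lborel F" and F2: "square_integrable F" and r: "0 < r"
  shows "complex_of_real (LINT \<omega>|lborel. (norm (fourier F \<omega>))\<^sup>2 * gauss (\<omega> /\<^sub>R r)) =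
           (LINT v|lborel. of_real (gauss_kernel v) * autocorrelation F (v /\<^sub>R r))"
proof -
  have [measurable]: "F \<in> borel_measurable borel" using F by auto
  let ?N = "LINT t|lborel. (norm (F t))\<^sup>2"
  \<comment> \<open>The conjugate transform with the cut-off; \<open>fourier F\<close> alone need not be integrable.\<close>
  let ?H = "\<lambda>\<omega>. cnj (fourier F \<omega>) * of_real (gauss (\<omega> /\<^sub>R r))"
  have H: "integrable lborel ?H"
    using integrable_norm_fourier_gauss[OF F r, of 1]
    by (rule Bochner_Integration.integrable_bound) (auto simp: norm_mult)
  let ?h = "\<lambda>v t. of_real (gauss_kernel v) * (F t * cnj (F (v /\<^sub>R r + t)))"
  have int_h: "integrable (lborel \<Otimes>\<^sub>M lborel) (\<lambda>(v, t). ?h v t)"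
  proof (rule lborel_pair.Fubini_integrable)
    show "(\<lambda>(v, t). ?h v t) \<in> borel_measurable (lborel \<Otimes>\<^sub>M lborel)" by measurable
    show "AE v in lborel. integrable lborel (\<lambda>t. case (v, t) of (v, t) \<Rightarrow> ?h v t)"
      by (simp only: prod.case)
         (intro AE_I2 integrable_mult_right integrable_mult_square_integrable
            square_integrable_cnj square_integrable_translate F2)
    show "integrable lborel (\<lambda>v. LINT t|lborel. norm (case (v, t) of (v, t) \<Rightarrow> ?h v t))"
    proof (rule Bochner_Integration.integrable_bound)
      show "integrable lborel (\<lambda>v::'a. gauss_kernel v * ?N)"
        by (intro integrable_mult_left integrable_gauss_kernel)
      let ?A = "\<lambda>t. complex_of_real (norm (F t))"
      have A: "square_integrable ?A" using F2 by (simp add: square_integrable_def)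
      have "norm (LINT t|lborel. norm (F t) * norm (F (u + t))) \<le> ?N" for u
      proof -
        have "complex_of_real (LINT t|lborel. norm (F t) * norm (F (u + t))) = autocorrelation ?A u"
          unfolding autocorrelation_def by (simp flip: of_real_mult)
        then have "norm (LINT t|lborel. norm (F t) * norm (F (u + t))) = norm (autocorrelation ?A u)"
          by (metis norm_of_real real_norm_def)
        then show ?thesis using norm_autocorrelation_le[OF A, of u] by simp
      qed
      then show "AE v in lborel. norm (LINT t|lborel. norm (case (v, t) of (v, t) \<Rightarrow> ?h v t)) \<le> norm (gauss_kernel v * ?N)"
        by (auto simp: norm_mult abs_mult gauss_kernel_nonneg intro!: mult_left_mono)
    qed measurable
  qed
  have fH: "fourier ?H t = (LINT v|lborel. cnj (F (v /\<^sub>R r + t)) * of_real (gauss_kernel v))" for t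
  proof -
    let ?m = "\<lambda>\<omega>. fourier F \<omega> * (of_real (gauss (\<omega> /\<^sub>R r)) * cnj (exp (- 2 * pi * \<i> * (t \<bullet> \<omega>))))"
    have "fourier ?H t = (LINT \<omega>|lborel. cnj (?m \<omega>))"
      unfolding fourier_def[of ?H]
      by (simp only: complex_cnj_mult complex_cnj_cnj complex_cnj_complex_of_real mult.assoc)
    also have "\<dots> = cnj (LINT \<omega>|lborel. ?m \<omega>)" by (rule Bochner_Integration.integral_cnj)
    also have "(LINT \<omega>|lborel. ?m \<omega>) = (LINT v|lborel. F (v /\<^sub>R r + t) * of_real (gauss_kernel v))"
      by (rule integral_fourier_modulated_gauss[OF F r])
    also have "cnj \<dots> = (LINT v|lborel. cnj (F (v /\<^sub>R r + t) * of_real (gauss_kernel v)))"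
      by (rule Bochner_Integration.integral_cnj[symmetric])
    finally show ?thesis by simp
  qed
  have "complex_of_real (LINT \<omega>|lborel. (norm (fourier F \<omega>))\<^sup>2 * gauss (\<omega> /\<^sub>R r)) =
      (LINT \<omega>|lborel. fourier F \<omega> * ?H \<omega>)"
    unfolding integral_complex_of_real[symmetric] of_real_mult complex_norm_square mult.assoc ..
  also have "\<dots> = (LINT t|lborel. F t * fourier ?H t)"
    by (rule fourier_multiplication_formula[OF F H])
  also have "\<dots> = (LINT t|lborel. LINT v|lborel. ?h v t)"
    unfolding fH by (simp add: mult_ac flip: integral_mult_right_zero)
  also have "\<dots> = (LINT v|lborel. LINT t|lborel. ?h v t)"
    by (rule lborel_pair.Fubini_integral[OF int_h])
  also have "\<dots> = (LINT v|lborel. of_real (gauss_kernel v) * autocorrelation F (v /\<^sub>R r))"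
    by (simp add: autocorrelation_def)
  finally show ?thesis .
qed

text \<open>
  As \<open>r\<close> grows, the truncated energies increase to the full energy of \<open>fourier F\<close>, while the weighted
  means of the autocorrelation tend to its value at \<open>0\<close>, which is the energy of \<open>F\<close>.
\<close>
lemma plancherel:
  fixes F :: "'a::euclidean_space \<Rightarrow> complex"
  assumes F: "integrable lborel F" and F2: "square_integrable F"
  shows "(\<integral>\<^sup>+\<omega>. ennreal ((norm (fourier F \<omega>))\<^sup>2) \<partial>lborel) = ennreal (LINT t|lborel. (norm (F t))\<^sup>2)"
proof -
  have [measurable]: "F \<in> borel_measurable borel" using F by auto
  let ?N = "LINT t|lborel. (norm (F t))\<^sup>2"
  let ?g = "\<lambda>n \<omega>. (norm (fourier F \<omega>))\<^sup>2 * gauss (\<omega> /\<^sub>R real (Suc n))"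
  have "(\<lambda>n. \<integral>\<^sup>+\<omega>. ennreal (?g n \<omega>) \<partial>lborel) \<longlonglongrightarrow> (\<integral>\<^sup>+\<omega>. ennreal ((norm (fourier F \<omega>))\<^sup>2) \<partial>lborel)"
  proof (rule nn_integral_LIMSEQ)
    show "incseq (\<lambda>n \<omega>. ennreal (?g n \<omega>))"
    proof (intro monoI le_funI ennreal_leI mult_left_mono)
      fix m n :: nat and \<omega> :: 'a assume "m \<le> n"
      then have "norm \<omega> / real (Suc n) \<le> norm \<omega> / real (Suc m)"
        by (intro divide_left_mono) auto
      then have "(norm (\<omega> /\<^sub>R real (Suc n)))\<^sup>2 \<le> (norm (\<omega> /\<^sub>R real (Suc m)))\<^sup>2"
        by (intro power_mono) (auto simp: divide_inverse mult.commute)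
      then show "gauss (\<omega> /\<^sub>R real (Suc m)) \<le> gauss (\<omega> /\<^sub>R real (Suc n))" unfolding gauss_def by simp
    qed simp
    fix \<omega> :: 'a
    have "(\<lambda>n. \<omega> /\<^sub>R real (Suc n)) \<longlonglongrightarrow> 0 *\<^sub>R \<omega>"
      by (intro tendsto_intros LIMSEQ_inverse_real_of_nat)
    then have "(\<lambda>n. gauss (\<omega> /\<^sub>R real (Suc n))) \<longlonglongrightarrow> exp (- (norm (0 *\<^sub>R \<omega>))\<^sup>2 / 2)"
      unfolding gauss_def by (intro tendsto_exp tendsto_divide tendsto_minus tendsto_power tendsto_norm
        tendsto_const) auto
    then have "(\<lambda>n. ?g n \<omega>) \<longlonglongrightarrow> (norm (fourier F \<omega>))\<^sup>2 * 1"
      by (intro tendsto_mult tendsto_const) simp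
    then show "(\<lambda>n. ennreal (?g n \<omega>)) \<longlonglongrightarrow> ennreal ((norm (fourier F \<omega>))\<^sup>2)"
      by (intro tendsto_ennrealI) simp
  qed measurable
  moreover have "(\<lambda>n. \<integral>\<^sup>+\<omega>. ennreal (?g n \<omega>) \<partial>lborel) \<longlonglongrightarrow> ennreal ?N"
  proof -
    have "(\<lambda>n. LINT v|lborel. of_real (gauss_kernel v) * autocorrelation F (v /\<^sub>R real (Suc n))) \<longlonglongrightarrow>
        (LINT v|lborel. complex_of_real (gauss_kernel (v::'a)) * of_real ?N)"
    proof (rule integral_dominated_convergence)
      show "integrable lborel (\<lambda>v::'a. gauss_kernel v * ?N)" by (intro integrable_mult_left integrable_gauss_kernel)
      have "(\<lambda>n. v /\<^sub>R real (Suc n)) \<longlonglongrightarrow> 0 *\<^sub>R v" for v :: 'a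
        by (intro tendsto_intros LIMSEQ_inverse_real_of_nat)
      then have X: "(\<lambda>n. v /\<^sub>R real (Suc n)) \<longlonglongrightarrow> 0" for v :: 'a
        by simp
      show "AE v in lborel. (\<lambda>n. of_real (gauss_kernel v) * autocorrelation F (v /\<^sub>R real (Suc n)))
          \<longlonglongrightarrow> of_real (gauss_kernel v) * of_real ?N"
        by (intro AE_I2 tendsto_mult tendsto_const autocorrelation_tendsto F2 X)
      show "AE v in lborel. norm (of_real (gauss_kernel v) * autocorrelation F (v /\<^sub>R real (Suc n))) \<le> gauss_kernel v * ?N" for n
        by (intro AE_I2) (simp add: norm_mult gauss_kernel_nonneg mult_left_mono norm_autocorrelation_le[OF F2])
    qed measurable
    moreover have "(LINT v|lborel. complex_of_real (gauss_kernel (v::'a)) * of_real ?N) = of_real ?N"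
      using integral_gauss_kernel[where 'a='a] by (simp flip: of_real_mult)
    ultimately have "(\<lambda>n. complex_of_real (LINT \<omega>|lborel. ?g n \<omega>)) \<longlonglongrightarrow> of_real ?N"
      by (simp only: integral_norm_fourier_gauss[OF F F2 of_nat_0_less_iff[THEN iffD2, OF zero_less_Suc]])
    then have "(\<lambda>n. ennreal (LINT \<omega>|lborel. ?g n \<omega>)) \<longlonglongrightarrow> ennreal ?N"
      by (intro tendsto_ennrealI) (simp only: tendsto_of_real_iff)
    moreover have "(\<integral>\<^sup>+\<omega>. ennreal (?g n \<omega>) \<partial>lborel) = ennreal (LINT \<omega>|lborel. ?g n \<omega>)" for n
      by (rule nn_integral_eq_integral[OF integrable_norm_fourier_gauss[OF F]]) (auto simp: gauss_def)
    ultimately show ?thesis by simp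
  qed
  ultimately show ?thesis by (rule LIMSEQ_unique)
qed

section \<open>Moyal's identity\<close>

lemma nn_integral_reflect:
  fixes t :: "'a::euclidean_space"
  assumes [measurable]: "f \<in> borel_measurable borel"
  shows "(\<integral>\<^sup>+x. f (t - x) \<partial>lborel) = (\<integral>\<^sup>+x. f x \<partial>lborel)"
proof -
  have "lborel = distr lborel borel (\<lambda>x. t - x)"
    using lborel_affine[of "- 1" t] by (simp add: density_1)
  then have "(\<integral>\<^sup>+x. f x \<partial>lborel) = (\<integral>\<^sup>+x. f x \<partial>distr lborel borel (\<lambda>x. t - x))"
    by simp
  then show ?thesis by (simp add: nn_integral_distr)
qed

text \<open>
  For fixed \<open>x\<close>, the short-time Fourier transform is the Fourier transform of
  \<open>t \<mapsto> f t * cnj (g (t - x))\<close>.  This product is integrable for every \<open>x\<close> but in general square-integrable only for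
  almost every \<open>x\<close>; for those \<open>x\<close> Plancherel's identity applies, and Tonelli's theorem separates \<open>f\<close>
  from \<open>g\<close>.
\<close>
lemma moyal_functions:
  fixes f g :: "'a::euclidean_space \<Rightarrow> complex"
  assumes f: "square_integrable f" and g: "square_integrable g"
  shows "(\<integral>\<^sup>+x. \<integral>\<^sup>+\<omega>. ennreal ((norm (fourier (\<lambda>t. f t * cnj (g (t - x))) \<omega>))\<^sup>2) \<partial>lborel \<partial>lborel) =
           ennreal ((LINT t|lborel. (norm (g t))\<^sup>2) * (LINT t|lborel. (norm (f t))\<^sup>2))"
proof -
  have [measurable]: "f \<in> borel_measurable borel" "g \<in> borel_measurable borel" using f g by auto
  have f2: "integrable lborel (\<lambda>t. (norm (f t))\<^sup>2)" and g2: "integrable lborel (\<lambda>t. (norm (g t))\<^sup>2)"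
    using f g by (auto simp: square_integrable_def)
  let ?F = "\<lambda>x t. f t * cnj (g (t - x))"
  have "(\<integral>\<^sup>+x. \<integral>\<^sup>+t. ennreal ((norm (?F x t))\<^sup>2) \<partial>lborel \<partial>lborel) =
      (\<integral>\<^sup>+t. \<integral>\<^sup>+x. ennreal ((norm (?F x t))\<^sup>2) \<partial>lborel \<partial>lborel)"
    by (rule lborel_pair.Fubini'[symmetric]) measurable
  also have "\<dots> = (\<integral>\<^sup>+t. ennreal ((norm (f t))\<^sup>2) * (\<integral>\<^sup>+x. ennreal ((norm (g (t - x)))\<^sup>2) \<partial>lborel) \<partial>lborel)"
    by (subst nn_integral_cmult[symmetric]) (auto simp: norm_mult power_mult_distrib ennreal_mult)
  also have "\<dots> = (\<integral>\<^sup>+t. ennreal ((norm (f t))\<^sup>2) * ennreal (LINT t|lborel. (norm (g t))\<^sup>2) \<partial>lborel)"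
    by (subst nn_integral_reflect[where f="\<lambda>x. ennreal ((norm (g x))\<^sup>2)"])
       (auto simp: nn_integral_eq_integral[OF g2])
  also have "\<dots> = ennreal ((LINT t|lborel. (norm (g t))\<^sup>2) * (LINT t|lborel. (norm (f t))\<^sup>2))"
    by (subst nn_integral_multc) (auto simp: nn_integral_eq_integral[OF f2] ennreal_mult mult.commute)
  finally have tonelli: "(\<integral>\<^sup>+x. \<integral>\<^sup>+t. ennreal ((norm (?F x t))\<^sup>2) \<partial>lborel \<partial>lborel) =
      ennreal ((LINT t|lborel. (norm (g t))\<^sup>2) * (LINT t|lborel. (norm (f t))\<^sup>2))" .
  have "AE x in lborel. (\<integral>\<^sup>+t. ennreal ((norm (?F x t))\<^sup>2) \<partial>lborel) \<noteq> \<infinity>"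
    by (rule nn_integral_PInf_AE) (auto simp: tonelli)
  then have "AE x in lborel. (\<integral>\<^sup>+\<omega>. ennreal ((norm (fourier (?F x) \<omega>))\<^sup>2) \<partial>lborel) =
      (\<integral>\<^sup>+t. ennreal ((norm (?F x t))\<^sup>2) \<partial>lborel)"
  proof eventually_elim
    fix x assume "(\<integral>\<^sup>+t. ennreal ((norm (?F x t))\<^sup>2) \<partial>lborel) \<noteq> \<infinity>"
    then have int: "integrable lborel (\<lambda>t. (norm (?F x t))\<^sup>2)"
      by (intro integrableI_bounded) (auto simp: less_top)
    then have sq: "square_integrable (?F x)"
      by (auto simp: square_integrable_def)
    have "integrable lborel (?F x)"
      using integrable_mult_square_integrable[OF f square_integrable_cnj[OF square_integrable_translate[OF g, of "- x"]]]
      by simp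
    from plancherel[OF this sq] show "(\<integral>\<^sup>+\<omega>. ennreal ((norm (fourier (?F x) \<omega>))\<^sup>2) \<partial>lborel) =
        (\<integral>\<^sup>+t. ennreal ((norm (?F x t))\<^sup>2) \<partial>lborel)"
      by (simp add: nn_integral_eq_integral[OF int])
  qed
  then show ?thesis
    unfolding tonelli[symmetric] by (rule nn_integral_cong_AE)
qed

lemma l2_rel_rep_l2: "l2_rel (rep_l2 f) (rep_l2 f)"
  using Quotient_rep_reflp[OF Quotient_l2] .

lemma square_integrable_rep_l2: "square_integrable (rep_l2 f)"
  using l2_rel_rep_l2[of f] by (simp add: l2_rel_def)

lemma measurable_rep_l2 [measurable]: "rep_l2 f \<in> borel_measurable borel"
  using square_integrable_rep_l2[of f] by auto

lemma AE_rep_abs_l2: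
  assumes "square_integrable F" shows "AE t in lborel. rep_l2 (abs_l2 F) t = F t"
  using Quotient_rep_abs[OF Quotient_l2, of F] assms by (simp add: l2_rel_def)

lemma power2_norm_l2: "(norm f)\<^sup>2 = (LINT t|lborel. (norm (rep_l2 f t))\<^sup>2)"
  by (simp add: power2_norm_eq_inner inner_l2.rep_eq)

lemma AE_rep_l2_diff: "AE t in lborel. rep_l2 (f - g) t = rep_l2 f t - rep_l2 g t"
proof -
  have "f - g = abs_l2 (\<lambda>t. rep_l2 f t - rep_l2 g t)"
    using minus_l2.abs_eq[OF l2_rel_rep_l2[of f] l2_rel_rep_l2[of g]]
    unfolding Quotient_abs_rep[OF Quotient_l2] .
  then show ?thesis
    using AE_rep_abs_l2[OF square_integrable_diff[OF square_integrable_rep_l2[of f] square_integrable_rep_l2[of g]]]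
    by simp
qed

text \<open>
  The complex conjugate of the time-frequency shift \<open>M\<^sub>\<omega> T\<^sub>x g\<close> at \<open>z = (x, \<omega>)\<close>, so that \<open>stft g f z\<close> is the
  integral of \<open>f\<close> times it.
\<close>
definition tf_atom :: "('a::euclidean_space \<Rightarrow> complex) \<Rightarrow> 'a \<times> 'a \<Rightarrow> 'a \<Rightarrow> complex" where
  "tf_atom g z t = cnj (g (t - fst z)) * exp (- 2 * pi * \<i> * (snd z \<bullet> t))"

lemma stft_eq_tf_atom: "stft g f z = (LINT t|lborel. rep_l2 f t * tf_atom (rep_l2 g) z t)"
  by (cases z) (simp add: stft.rep_eq tf_atom_def mult.assoc)

lemma measurable_stft [measurable]: "stft g f \<in> borel_measurable borel"
proof -
  have "(\<lambda>z. LINT t|lborel. rep_l2 f t * (cnj (rep_l2 g (t - fst z)) * exp (- 2 * pi * \<i> * (snd z \<bullet> t))))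
      \<in> borel_measurable (borel \<Otimes>\<^sub>M borel)"
    by measurable
  then show ?thesis
    by (simp add: stft_eq_tf_atom[abs_def] tf_atom_def borel_prod)
qed

lemma moyal: "(\<integral>\<^sup>+z. ennreal ((norm (stft g f z))\<^sup>2) \<partial>lborel) = ennreal ((norm g)\<^sup>2 * (norm f)\<^sup>2)"
proof -
  have "(\<integral>\<^sup>+z. ennreal ((norm (stft g f z))\<^sup>2) \<partial>lborel) =
      (\<integral>\<^sup>+z. ennreal ((norm (stft g f z))\<^sup>2) \<partial>(lborel \<Otimes>\<^sub>M lborel))"
    by (simp add: lborel_prod)
  also have "\<dots> = (\<integral>\<^sup>+x. \<integral>\<^sup>+\<omega>. ennreal ((norm (stft g f (x, \<omega>)))\<^sup>2) \<partial>lborel \<partial>lborel)"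
    by (rule lborel.nn_integral_fst[symmetric]) (simp add: lborel_prod)
  also have "\<dots> = ennreal ((norm g)\<^sup>2 * (norm f)\<^sup>2)"
    using moyal_functions[OF square_integrable_rep_l2[of f] square_integrable_rep_l2[of g]]
    by (simp add: power2_norm_l2 stft.rep_eq fourier_def)
  finally show ?thesis .
qed

lemma integrable_stft: "integrable lborel (\<lambda>z. (norm (stft g f z))\<^sup>2)"
  by (rule integrableI_bounded) (auto simp: moyal)

lemma integral_norm_stft: "(LINT z|lborel. (norm (stft g f z))\<^sup>2) = (norm g)\<^sup>2 * (norm f)\<^sup>2"
  using nn_integral_eq_integral[OF integrable_stft[of g f]] moyal[of g f] by simp

section \<open>Equicontinuity of short-time Fourier transforms\<close>

lemma square_integrable_tf_atom:
  assumes "square_integrable g" shows "square_integrable (tf_atom g z)"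
proof -
  have [measurable]: "g \<in> borel_measurable borel" using assms by auto
  have "tf_atom g z \<in> borel_measurable borel" unfolding tf_atom_def[abs_def] by measurable
  moreover have "norm (tf_atom g z t) = norm (g (- fst z + t))" for t
    by (simp add: tf_atom_def norm_mult)
  ultimately show ?thesis
    using square_integrable_translate[OF assms, of "- fst z"] by (simp add: square_integrable_def)
qed

lemma integral_norm_tf_atom:
  assumes "square_integrable g"
  shows "(LINT t|lborel. (norm (tf_atom g z t))\<^sup>2) = (LINT t|lborel. (norm (g t))\<^sup>2)"
proof -
  have "norm (tf_atom g z t) = norm (g (- fst z + t))" for t
    by (simp add: tf_atom_def norm_mult)
  then show ?thesis using integral_norm_translate[OF assms, of "- fst z"] by simp
qed

lemma stft_diff: "stft g (f - f') z = stft g f z - stft g f' z"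
proof -
  note atom = square_integrable_tf_atom[OF square_integrable_rep_l2, of g z]
  have [measurable]: "tf_atom (rep_l2 g) z \<in> borel_measurable borel" using atom by auto
  have "stft g (f - f') z = (LINT t|lborel. (rep_l2 f t - rep_l2 f' t) * tf_atom (rep_l2 g) z t)"
    unfolding stft_eq_tf_atom
    by (rule integral_cong_AE) (use AE_rep_l2_diff[of f f'] in auto)
  also have "\<dots> = stft g f z - stft g f' z"
    unfolding stft_eq_tf_atom left_diff_distrib
    by (intro Bochner_Integration.integral_diff integrable_mult_square_integrable
        square_integrable_rep_l2 atom)
  finally show ?thesis .
qed

lemma norm_stft_le: "norm (stft g f z) \<le> norm g * norm f"
proof -
  note g = square_integrable_rep_l2[of g]
  have "norm (stft g f z) \<le> sqrt ((norm f)\<^sup>2) * sqrt ((norm g)\<^sup>2)"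
    using norm_integral_mult_le[OF square_integrable_rep_l2[of f] square_integrable_tf_atom[OF g, of z]]
    by (simp only: stft_eq_tf_atom integral_norm_tf_atom[OF g] power2_norm_l2)
  then show ?thesis by (simp add: mult.commute)
qed

lemma power2_norm_add_le:
  fixes a b :: "'a::real_normed_vector"
  shows "(norm (a + b))\<^sup>2 \<le> 2 * (norm a)\<^sup>2 + 2 * (norm b)\<^sup>2"
proof -
  have "(norm (a + b))\<^sup>2 \<le> (norm a + norm b)\<^sup>2"
    by (intro power_mono norm_triangle_ineq) simp
  also have "\<dots> \<le> 2 * (norm a)\<^sup>2 + 2 * (norm b)\<^sup>2"
    using sum_squares_bound[of "norm a" "norm b"] unfolding power2_sum by linarith
  finally show ?thesis .
qed

text \<open>
  The difference of two time-frequency shifts splits into a difference of translates, small by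
  continuity of translations, and a difference of modulations of one fixed translate, small by dominated
  convergence.
\<close>
lemma tf_atom_tendsto:
  fixes g :: "'a::euclidean_space \<Rightarrow> complex"
  assumes g: "square_integrable g" and Z: "Z \<longlonglongrightarrow> z"
  shows "(\<lambda>n. LINT t|lborel. (norm (tf_atom g (Z n) t - tf_atom g z t))\<^sup>2) \<longlonglongrightarrow> 0"
proof -
  have [measurable]: "g \<in> borel_measurable borel" using g by auto
  let ?e = "\<lambda>z t. exp (- 2 * pi * \<i> * (snd z \<bullet> t))"
  \<comment> \<open>The translate of \<open>g\<close> that belongs to \<open>z\<close>; the one for \<open>Z n\<close> is its translate by \<open>?X n\<close>.\<close>
  let ?h = "\<lambda>t. g (- fst z + t)"
  have h: "square_integrable ?h" by (rule square_integrable_translate[OF g])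
  let ?X = "\<lambda>n. fst z - fst (Z n)"
  have X: "?X \<longlonglongrightarrow> 0"
    using tendsto_diff[OF tendsto_const tendsto_fst[OF Z], of "fst z"] by simp
  have transl: "(\<lambda>n. LINT t|lborel. (norm (?h (?X n + t) - ?h t))\<^sup>2) \<longlonglongrightarrow> 0"
    by (rule L2_translation_continuous[OF h X])
  have modul: "(\<lambda>n. LINT t|lborel. (norm (cnj (?h t) * (?e (Z n) t - ?e z t)))\<^sup>2) \<longlonglongrightarrow>
      (LINT t|(lborel :: 'a measure). (0::real))"
  proof (rule integral_dominated_convergence)
    show "integrable lborel (\<lambda>t. 4 * (norm (?h t))\<^sup>2)"
      using h by (simp add: square_integrable_def)
    have "(\<lambda>n. (norm (cnj (?h t) * (?e (Z n) t - ?e z t)))\<^sup>2) \<longlonglongrightarrow>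
        (norm (cnj (?h t) * (?e z t - ?e z t)))\<^sup>2" for t
      by (intro tendsto_intros Z)
    then show "AE t in lborel. (\<lambda>n. (norm (cnj (?h t) * (?e (Z n) t - ?e z t)))\<^sup>2) \<longlonglongrightarrow> 0" by simp
    have "norm ((norm (cnj (?h t) * (?e (Z n) t - ?e z t)))\<^sup>2) \<le> 4 * (norm (?h t))\<^sup>2" for n t
    proof -
      have "norm (?e (Z n) t - ?e z t) \<le> 2"
        using norm_triangle_ineq4[of "?e (Z n) t" "?e z t"] by (simp only: norm_character)
      then have "(norm (?e (Z n) t - ?e z t))\<^sup>2 \<le> 2\<^sup>2" by (intro power_mono) auto
      from mult_left_mono[OF this, of "(norm (?h t))\<^sup>2"] show ?thesis
        by (simp add: norm_mult power_mult_distrib mult.commute)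
    qed
    then show "AE t in lborel. norm ((norm (cnj (?h t) * (?e (Z n) t - ?e z t)))\<^sup>2) \<le> 4 * (norm (?h t))\<^sup>2" for n
      by simp
  qed measurable
  let ?r = "\<lambda>n. 2 * (LINT t|lborel. (norm (?h (?X n + t) - ?h t))\<^sup>2) +
      2 * (LINT t|lborel. (norm (cnj (?h t) * (?e (Z n) t - ?e z t)))\<^sup>2)"
  have lim: "?r \<longlonglongrightarrow> 0"
    using transl modul by (intro tendsto_add_zero tendsto_mult_right_zero) auto
  have le: "(LINT t|lborel. (norm (tf_atom g (Z n) t - tf_atom g z t))\<^sup>2) \<le> ?r n" for n
  proof -
    let ?a = "\<lambda>t. ?h (?X n + t) - ?h t" and ?b = "\<lambda>t. cnj (?h t) * (?e (Z n) t - ?e z t)"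
    have a: "integrable lborel (\<lambda>t. (norm (?a t))\<^sup>2)"
      using square_integrable_diff[OF square_integrable_translate[OF h, of "?X n"] h]
      by (simp add: square_integrable_def)
    have "?b t = cnj (?h t) * ?e (Z n) t - tf_atom g z t" for t
      by (simp add: tf_atom_def right_diff_distrib)
    moreover have "cnj (?h t) * ?e (Z n) t = tf_atom g (fst z, snd (Z n)) t" for t
      by (simp add: tf_atom_def)
    ultimately have b: "integrable lborel (\<lambda>t. (norm (?b t))\<^sup>2)"
      using square_integrable_diff[OF square_integrable_tf_atom[OF g, of "(fst z, snd (Z n))"]
          square_integrable_tf_atom[OF g, of z]]
      by (simp add: square_integrable_def)
    have "(LINT t|lborel. (norm (tf_atom g (Z n) t - tf_atom g z t))\<^sup>2) \<le>
        (LINT t|lborel. 2 * (norm (?a t))\<^sup>2 + 2 * (norm (?b t))\<^sup>2)"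
    proof (rule integral_mono')
      show "integrable lborel (\<lambda>t. 2 * (norm (?a t))\<^sup>2 + 2 * (norm (?b t))\<^sup>2)"
        using a b by (intro Bochner_Integration.integrable_add integrable_mult_right) auto
      fix t
      have "tf_atom g (Z n) t - tf_atom g z t = cnj (?a t) * ?e (Z n) t + ?b t"
        by (simp add: tf_atom_def algebra_simps)
      moreover have "norm (cnj (?a t) * ?e (Z n) t) = norm (?a t)"
        by (simp only: norm_mult norm_character complex_mod_cnj mult_1_right)
      ultimately show "(norm (tf_atom g (Z n) t - tf_atom g z t))\<^sup>2 \<le>
          2 * (norm (?a t))\<^sup>2 + 2 * (norm (?b t))\<^sup>2"
        using power2_norm_add_le[of "cnj (?a t) * ?e (Z n) t" "?b t"] by (simp only:)
    qed auto
    also have "\<dots> = ?r n"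
      using a b by (subst Bochner_Integration.integral_add) auto
    finally show ?thesis .
  qed
  show ?thesis
    by (rule real_tendsto_sandwich[OF _ _ tendsto_const lim]) (simp, intro always_eventually allI le)
qed

text \<open>
  By Cauchy-Schwarz, the modulus of continuity of \<open>stft g f\<close> is at most \<open>norm f\<close> times that of
  \<open>z \<mapsto> M\<^sub>\<omega> T\<^sub>x g\<close>; hence \<open>d\<close> is independent of \<open>f\<close>.
\<close>
lemma stft_equicontinuous:
  fixes g :: "'a::euclidean_space l2"
  assumes "0 < e"
  shows "\<exists>d>0. \<forall>y f. norm (z - y) < d \<longrightarrow> norm (stft g f z - stft g f y) \<le> norm f * e"
proof -
  note g = square_integrable_rep_l2[of g]
  let ?D = "\<lambda>y. sqrt (LINT t|lborel. (norm (tf_atom (rep_l2 g) y t - tf_atom (rep_l2 g) z t))\<^sup>2)"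
  have "continuous (at z) ?D"
    unfolding continuous_at_sequentially
    using tendsto_real_sqrt[OF tf_atom_tendsto[OF g]] by (auto simp: o_def)
  then obtain d where d: "d > 0" "\<And>y. dist y z < d \<Longrightarrow> dist (?D y) (?D z) < e"
    unfolding continuous_at_eps_delta using assms by blast
  have "norm (stft g f z - stft g f y) \<le> norm f * e" if "norm (z - y) < d" for y f
  proof -
    have "\<bar>?D y - ?D z\<bar> < e"
      using d(2)[of y] that by (simp only: dist_real_def dist_norm norm_minus_commute)
    moreover have "?D z = 0" by simp
    ultimately have "?D y \<le> e" by linarith
    have "stft g f y - stft g f z = (LINT t|lborel. rep_l2 f t * (tf_atom (rep_l2 g) y t - tf_atom (rep_l2 g) z t))"
      unfolding stft_eq_tf_atom right_diff_distrib
      by (intro Bochner_Integration.integral_diff[symmetric] integrable_mult_square_integrable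
          square_integrable_rep_l2 square_integrable_tf_atom[OF g])
    then have "norm (stft g f z - stft g f y) \<le> norm f * ?D y"
      using norm_integral_mult_le[OF square_integrable_rep_l2[of f]
          square_integrable_diff[OF square_integrable_tf_atom[OF g, of y] square_integrable_tf_atom[OF g, of z]]]
      by (simp add: norm_minus_commute power2_norm_l2[symmetric])
    also have "\<dots> \<le> norm f * e" using \<open>?D y \<le> e\<close> by (intro mult_left_mono) auto
    finally show ?thesis .
  qed
  with d(1) show ?thesis by blast
qed

section \<open>Completeness of the space of square-integrable functions\<close>

lemma Cauchy_fast_subseq:
  fixes X :: "nat \<Rightarrow> 'a::metric_space"
  assumes X: "Cauchy X" and c: "\<And>n. 0 < c n"
  obtains k :: "nat \<Rightarrow> nat" where "strict_mono k" "\<And>n m. k n \<le> m \<Longrightarrow> dist (X (k n)) (X m) < c n"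
proof -
  have "\<exists>k. \<forall>n. (\<forall>m\<ge>k n. dist (X (k n)) (X m) < c n) \<and> k n < k (Suc n)"
  proof (rule dependent_nat_choice)
    fix n p
    obtain M where "\<forall>i\<ge>M. \<forall>m\<ge>M. dist (X i) (X m) < c (Suc n)"
      using X c[of "Suc n"] unfolding Cauchy_def by blast
    then show "\<exists>q. (\<forall>m\<ge>q. dist (X q) (X m) < c (Suc n)) \<and> p < q"
      by (intro exI[of _ "max M (Suc p)"]) auto
  next
    obtain M where "\<forall>i\<ge>M. \<forall>m\<ge>M. dist (X i) (X m) < c 0"
      using X c[of 0] unfolding Cauchy_def by blast
    then show "\<exists>q. \<forall>m\<ge>q. dist (X q) (X m) < c 0" by blast
  qed
  then show ?thesis using that by (auto simp: strict_mono_Suc_iff)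
qed

lemma nn_integral_norm_diff_l2:
  "(\<integral>\<^sup>+t. ennreal ((norm (rep_l2 f t - rep_l2 g t))\<^sup>2) \<partial>lborel) = ennreal ((dist f g)\<^sup>2)"
proof -
  have int: "integrable lborel (\<lambda>t. (norm (rep_l2 (f - g) t))\<^sup>2)"
    using square_integrable_rep_l2[of "f - g"] by (simp add: square_integrable_def)
  have "(\<integral>\<^sup>+t. ennreal ((norm (rep_l2 f t - rep_l2 g t))\<^sup>2) \<partial>lborel) =
      (\<integral>\<^sup>+t. ennreal ((norm (rep_l2 (f - g) t))\<^sup>2) \<partial>lborel)"
    using AE_rep_l2_diff[of f g] by (intro nn_integral_cong_AE) auto
  also have "\<dots> = ennreal ((dist f g)\<^sup>2)"
    by (simp add: nn_integral_eq_integral[OF int] dist_norm power2_norm_l2)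
  finally show ?thesis .
qed

text \<open>
  The distances decay so fast that \<open>\<Sum>n. 4\<^sup>n |Y (n + 1) - Y n|\<^sup>2\<close> has a finite integral.  At almost every
  point the sum is finite, so there the increments are of size \<open>2\<^sup>-\<^sup>n\<close> and summable.
\<close>
lemma AE_convergent_of_fast_l2:
  fixes Y :: "nat \<Rightarrow> 'a::euclidean_space l2"
  assumes fast: "\<And>n. dist (Y (Suc n)) (Y n) \<le> (1 / 4) ^ n"
  shows "AE t in lborel. convergent (\<lambda>n. rep_l2 (Y n) t)"
proof -
  let ?d = "\<lambda>n t. norm (rep_l2 (Y (Suc n)) t - rep_l2 (Y n) t)"
  have "(\<integral>\<^sup>+t. (\<Sum>n. ennreal (4 ^ n * (?d n t)\<^sup>2)) \<partial>lborel) =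
      (\<Sum>n. \<integral>\<^sup>+t. ennreal (4 ^ n * (?d n t)\<^sup>2) \<partial>lborel)"
    by (rule nn_integral_suminf) measurable
  also have "\<dots> = (\<Sum>n. ennreal (4 ^ n * (dist (Y (Suc n)) (Y n))\<^sup>2))"
    by (simp add: ennreal_mult nn_integral_cmult nn_integral_norm_diff_l2)
  also have "\<dots> \<le> (\<Sum>n. ennreal ((1 / 4) ^ n))"
  proof (intro suminf_le ennreal_leI summableI)
    fix n
    have "4 ^ n * (dist (Y (Suc n)) (Y n))\<^sup>2 \<le> 4 ^ n * ((1 / 4) ^ n)\<^sup>2"
      using fast[of n] by (intro mult_left_mono power_mono) auto
    also have "\<dots> = (1 / 4) ^ n" by (simp add: power2_eq_square power_divide)
    finally show "4 ^ n * (dist (Y (Suc n)) (Y n))\<^sup>2 \<le> (1 / 4) ^ n" .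
  qed
  also have "\<dots> < \<infinity>"
    by (simp add: ennreal_suminf_neq_top less_top[symmetric] summable_geometric)
  finally have "AE t in lborel. (\<Sum>n. ennreal (4 ^ n * (?d n t)\<^sup>2)) \<noteq> \<infinity>"
    by (intro nn_integral_PInf_AE) auto
  then show ?thesis
  proof eventually_elim
    fix t assume fin: "(\<Sum>n. ennreal (4 ^ n * (?d n t)\<^sup>2)) \<noteq> \<infinity>"
    then have "summable (\<lambda>n. 4 ^ n * (?d n t)\<^sup>2)"
      by (intro summable_suminf_not_top) auto
    from BseqE[OF summable_imp_Bseq[OF this]] obtain C where C: "\<And>n. norm (4 ^ n * (?d n t)\<^sup>2) \<le> C"
      by blast
    have "?d n t \<le> sqrt C * (1 / 2) ^ n" for n
    proof (rule power2_le_imp_le)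
      have "0 \<le> C" using C[of 0] norm_ge_zero order_trans by blast
      have "4 ^ n * (?d n t)\<^sup>2 \<le> C" using C[of n] by simp
      then have "(?d n t)\<^sup>2 \<le> C * (1 / 4) ^ n"
        by (simp add: power_divide field_simps)
      also have "(1 / 4 :: real) ^ n = ((1 / 2) ^ n)\<^sup>2"
        by (simp add: power_mult[symmetric] mult.commute[of n 2]) (simp add: power_mult power2_eq_square)
      also have "C * ((1 / 2) ^ n)\<^sup>2 = (sqrt C * (1 / 2) ^ n)\<^sup>2"
        using \<open>0 \<le> C\<close> by (simp add: power_mult_distrib)
      finally show "(?d n t)\<^sup>2 \<le> (sqrt C * (1 / 2) ^ n)\<^sup>2" .
      show "0 \<le> sqrt C * (1 / 2) ^ n" using \<open>0 \<le> C\<close> by simp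
    qed
    then have "summable (\<lambda>n. rep_l2 (Y (Suc n)) t - rep_l2 (Y n) t)"
      by (intro summable_comparison_test'[where N=0, OF summable_mult[OF summable_geometric]]) auto
    then have "convergent (\<lambda>n. rep_l2 (Y n) t - rep_l2 (Y 0) t)"
      unfolding summable_iff_convergent sum_lessThan_telescope[of "\<lambda>n. rep_l2 (Y n) t"] .
    then show "convergent (\<lambda>n. rep_l2 (Y n) t)"
      by (simp only: convergent_diff_const_right_iff)
  qed
qed

text \<open>
  The Riesz-Fischer theorem: a fast subsequence converges almost everywhere, and Fatou's lemma shows that
  the pointwise limit is also the limit in mean square.
\<close>
instance l2 :: (euclidean_space) complete_space
proof
  fix X :: "nat \<Rightarrow> 'a l2" assume X: "Cauchy X"
  obtain k where k: "strict_mono k"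
      and near: "\<And>n m. k n \<le> m \<Longrightarrow> dist (X (k n)) (X m) < (1 / 4) ^ n"
    using Cauchy_fast_subseq[OF X, of "\<lambda>n. (1 / 4) ^ n"] by auto
  define Y where "Y n = X (k n)" for n
  have Y: "dist (Y n) (Y m) \<le> (1 / 4) ^ n" if "n \<le> m" for n m
    using near[of n "k m"] strict_mono_leD[OF k that] by (simp add: Y_def less_imp_le)
  let ?Z = "\<lambda>t. lim (\<lambda>n. rep_l2 (Y n) t)"
  have conv: "AE t in lborel. (\<lambda>n. rep_l2 (Y n) t) \<longlonglongrightarrow> ?Z t"
    using AE_convergent_of_fast_l2[of Y] Y[of n "Suc n" for n]
    by (simp add: dist_commute convergent_LIMSEQ_iff)
  have bound: "(\<integral>\<^sup>+t. ennreal ((norm (?Z t - rep_l2 (Y m) t))\<^sup>2) \<partial>lborel) \<le> ennreal (((1 / 4) ^ m)\<^sup>2)" for m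
  proof -
    let ?u = "\<lambda>n t. ennreal ((norm (rep_l2 (Y n) t - rep_l2 (Y m) t))\<^sup>2)"
    have "AE t in lborel. ennreal ((norm (?Z t - rep_l2 (Y m) t))\<^sup>2) = liminf (\<lambda>n. ?u n t)"
      using conv
    proof eventually_elim
      fix t assume "(\<lambda>n. rep_l2 (Y n) t) \<longlonglongrightarrow> ?Z t"
      then have "(\<lambda>n. ?u n t) \<longlonglongrightarrow> ennreal ((norm (?Z t - rep_l2 (Y m) t))\<^sup>2)"
        by (intro tendsto_intros)
      then show "ennreal ((norm (?Z t - rep_l2 (Y m) t))\<^sup>2) = liminf (\<lambda>n. ?u n t)"
        by (intro lim_imp_Liminf[symmetric]) auto
    qed
    then have "(\<integral>\<^sup>+t. ennreal ((norm (?Z t - rep_l2 (Y m) t))\<^sup>2) \<partial>lborel) = (\<integral>\<^sup>+t. liminf (\<lambda>n. ?u n t) \<partial>lborel)"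
      by (rule nn_integral_cong_AE)
    also have "\<dots> \<le> liminf (\<lambda>n. \<integral>\<^sup>+t. ?u n t \<partial>lborel)"
      by (rule nn_integral_liminf) measurable
    also have "\<dots> \<le> ennreal (((1 / 4) ^ m)\<^sup>2)"
    proof (rule Liminf_le)
      have "(\<integral>\<^sup>+t. ?u n t \<partial>lborel) \<le> ennreal (((1 / 4) ^ m)\<^sup>2)" if "m \<le> n" for n
        unfolding nn_integral_norm_diff_l2 using Y[OF that]
        by (intro ennreal_leI power_mono) (auto simp: dist_commute)
      then show "\<forall>\<^sub>F n in sequentially. (\<integral>\<^sup>+t. ?u n t \<partial>lborel) \<le> ennreal (((1 / 4) ^ m)\<^sup>2)"
        by (auto simp: eventually_sequentially)
    qed simp
    finally show ?thesis .
  qed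
  have sqd: "square_integrable (\<lambda>t. ?Z t - rep_l2 (Y m) t)" for m
    unfolding square_integrable_def
    by (intro conjI integrableI_bounded) (auto intro: le_less_trans[OF bound])
  have sq: "square_integrable ?Z"
    using square_integrable_add[OF sqd[of 0] square_integrable_rep_l2[of "Y 0"]] by simp
  have "dist (Y m) (abs_l2 ?Z) \<le> (1 / 4) ^ m" for m
  proof -
    have "ennreal ((dist (abs_l2 ?Z) (Y m))\<^sup>2) =
        (\<integral>\<^sup>+t. ennreal ((norm (?Z t - rep_l2 (Y m) t))\<^sup>2) \<partial>lborel)"
      unfolding nn_integral_norm_diff_l2[symmetric]
      using AE_rep_abs_l2[OF sq] by (intro nn_integral_cong_AE) auto
    also note bound
    finally have "(dist (abs_l2 ?Z) (Y m))\<^sup>2 \<le> ((1 / 4) ^ m)\<^sup>2" by (simp add: ennreal_le_iff)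
    then show ?thesis by (subst dist_commute) (rule power2_le_imp_le, auto)
  qed
  then have "Y \<longlonglongrightarrow> abs_l2 ?Z"
    by (intro metric_tendsto_imp_tendsto[OF LIMSEQ_power_zero[of "1 / 4 :: real"]])
       (auto intro!: always_eventually)
  then have "X \<longlonglongrightarrow> abs_l2 ?Z"
    by (intro Cauchy_converges_subseq[OF X k]) (simp add: Y_def[abs_def] o_def)
  then show "convergent X" by (rule convergentI)
qed

section \<open>Energy of the short-time Fourier transform on a set\<close>

definition stft_energy :: "'a::euclidean_space l2 \<Rightarrow> ('a \<times> 'a) set \<Rightarrow> 'a l2 \<Rightarrow> real" where
  "stft_energy g A f = (LINT z|lborel. indicator A z * (norm (stft g f z))\<^sup>2)"

lemma integrable_stft_energy:
  assumes "A \<in> sets borel"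
  shows "integrable lborel (\<lambda>z. indicator A z * (norm (stft g f z))\<^sup>2)"
  by (rule Bochner_Integration.integrable_bound[OF integrable_stft[of g f]])
     (use assms in \<open>auto split: split_indicator\<close>)

lemma stft_energy_nonneg: "0 \<le> stft_energy g A f"
  unfolding stft_energy_def by simp

lemma l2_norm_on_stft:
  assumes "A \<in> sets borel"
  shows "l2_norm_on A (stft g f) = ennreal (sqrt (stft_energy g A f))"
proof -
  have "(\<integral>\<^sup>+z\<in>A. ennreal ((norm (stft g f z))\<^sup>2) \<partial>lborel) = (\<integral>\<^sup>+z. ennreal (indicator A z * (norm (stft g f z))\<^sup>2) \<partial>lborel)"
    by (intro nn_integral_cong) (auto split: split_indicator)
  also have "\<dots> = ennreal (stft_energy g A f)"
    unfolding stft_energy_def by (rule nn_integral_eq_integral[OF integrable_stft_energy[OF assms]]) simp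
  finally show ?thesis
    by (simp add: l2_norm_on_def Let_def stft_energy_nonneg)
qed

lemma stft_energy_compl:
  assumes "A \<in> sets borel"
  shows "stft_energy g A f + stft_energy g (- A) f = (norm g)\<^sup>2 * (norm f)\<^sup>2"
proof -
  have "stft_energy g A f + stft_energy g (- A) f =
      (LINT z|lborel. indicator A z * (norm (stft g f z))\<^sup>2 + indicator (- A) z * (norm (stft g f z))\<^sup>2)"
    unfolding stft_energy_def using assms
    by (intro Bochner_Integration.integral_add[symmetric] integrable_stft_energy) auto
  also have "\<dots> = (LINT z|lborel. (norm (stft g f z))\<^sup>2)"
    by (intro Bochner_Integration.integral_cong) (auto split: split_indicator)
  finally show ?thesis by (simp add: integral_norm_stft)
qed

lemma stft_energy_le:
  assumes "A \<in> sets borel"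
  shows "stft_energy g A f \<le> (norm g)\<^sup>2 * (norm f)\<^sup>2"
  using stft_energy_compl[OF assms, of g f] stft_energy_nonneg[of g "- A" f] by linarith

lemma stft_energy_diff_le:
  assumes "A \<in> sets borel"
  shows "stft_energy g A (f - h) \<le> 2 * stft_energy g A f + 2 * stft_energy g A h"
proof -
  note int = integrable_stft_energy[OF assms, of g]
  have "stft_energy g A (f - h) \<le> (LINT z|lborel. 2 * (indicator A z * (norm (stft g f z))\<^sup>2) +
      2 * (indicator A z * (norm (stft g h z))\<^sup>2))"
    unfolding stft_energy_def
  proof (rule integral_mono)
    show "indicator A z * (norm (stft g (f - h) z))\<^sup>2 \<le> 2 * (indicator A z * (norm (stft g f z))\<^sup>2) +
        2 * (indicator A z * (norm (stft g h z))\<^sup>2)" for z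
      using power2_norm_add_le[of "stft g f z" "- stft g h z"]
      by (auto simp: stft_diff split: split_indicator)
  qed (intro int Bochner_Integration.integrable_add integrable_mult_right)+
  also have "\<dots> = 2 * stft_energy g A f + 2 * stft_energy g A h"
    unfolding stft_energy_def using int by (subst Bochner_Integration.integral_add) auto
  finally show ?thesis .
qed

lemma stft_energy_tail:
  fixes g f :: "'a::euclidean_space l2"
  assumes "0 < e"
  shows "\<exists>U. compact U \<and> stft_energy g (- U) f < e"
proof -
  have "(\<lambda>n. stft_energy g (- cball 0 (real n)) f) \<longlonglongrightarrow> (LINT z|(lborel :: ('a \<times> 'a) measure). (0::real))"
    unfolding stft_energy_def
  proof (rule integral_dominated_convergence[OF _ _ integrable_stft[of g f]])
    have "(\<lambda>n. indicator (- cball 0 (real n)) z * (norm (stft g f z))\<^sup>2) \<longlonglongrightarrow> 0" for z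
    proof (rule tendsto_eventually)
      obtain N where "norm z \<le> real N" using real_arch_simple by blast
      then have "\<And>n. n \<ge> N \<Longrightarrow> z \<in> cball 0 (real n)" by (auto intro: order_trans)
      then show "\<forall>\<^sub>F n in sequentially. indicator (- cball 0 (real n)) z * (norm (stft g f z))\<^sup>2 = 0"
        unfolding eventually_sequentially by (intro exI[of _ N]) (simp add: indicator_def)
    qed
    then show "AE z in lborel. (\<lambda>n. indicator (- cball 0 (real n)) z * (norm (stft g f z))\<^sup>2) \<longlonglongrightarrow> 0"
      by simp
    show "AE z in lborel. norm (indicator (- cball 0 (real n)) z * (norm (stft g f z))\<^sup>2) \<le> (norm (stft g f z))\<^sup>2" for n
      by (auto split: split_indicator)
  qed measurable
  then have "\<forall>\<^sub>F n in sequentially. stft_energy g (- cball 0 (real n)) f < e"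
    using assms by (intro order_tendstoD) simp_all
  then obtain n where "stft_energy g (- cball 0 (real n)) f < e"
    by (auto simp: eventually_sequentially)
  then show ?thesis by (intro exI[of _ "cball 0 (real n)"]) simp
qed

lemma stft_energy_mono:
  assumes "A \<in> sets borel" "B \<in> sets borel" "A \<subseteq> B"
  shows "stft_energy g A f \<le> stft_energy g B f"
  unfolding stft_energy_def
  by (intro integral_mono integrable_stft_energy assms) (use assms(3) in \<open>auto split: split_indicator\<close>)

lemma stft_energy_le_sup:
  assumes U: "compact U" and c: "\<And>z. z \<in> U \<Longrightarrow> norm (stft g f z) \<le> c"
  shows "stft_energy g U f \<le> c\<^sup>2 * measure lborel U"
proof -
  have fin: "emeasure lborel U < \<infinity>" and [measurable]: "U \<in> sets borel"
    using emeasure_bounded_finite[OF compact_imp_bounded[OF U]] borel_compact[OF U] by simp_all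
  have "stft_energy g U f \<le> (LINT z|lborel. c\<^sup>2 * indicator U z)"
    unfolding stft_energy_def
  proof (intro integral_mono integrable_stft_energy)
    show "integrable lborel (\<lambda>z. c\<^sup>2 * indicator U z)"
      using fin by (intro integrable_mult_right integrable_real_indicator) auto
    show "indicator U z * (norm (stft g f z))\<^sup>2 \<le> c\<^sup>2 * indicator U z" for z
      using c[of z] by (auto split: split_indicator intro: power_mono)
  qed measurable
  then show ?thesis by simp
qed

text \<open>
  A single short-time Fourier transform has little energy outside a large ball.  Finitely many centres
  of a net of \<open>S\<close> share one compact set, and by Moyal's identity the remaining members of \<open>S\<close> differ from
  a centre by little energy, wherever it is located.
\<close>
lemma compact_imp_stft_tight:
  fixes g :: "'a::euclidean_space l2"
  assumes S: "compact S"
  shows "l2_tight {stft g f |f. f \<in> S}"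
  unfolding l2_tight_def
proof (intro allI impI)
  fix \<epsilon> :: real assume \<epsilon>: "0 < \<epsilon>"
  \<comment> \<open>The summand \<open>1\<close> keeps the denominator positive when \<open>g = 0\<close>.\<close>
  define \<delta> where "\<delta> = (\<epsilon> / 4) / (norm g + 1)"
  have \<delta>: "0 < \<delta>" using \<epsilon> by (simp add: \<delta>_def add_nonneg_pos)
  have "norm g * \<delta> \<le> \<epsilon> / 4"
    unfolding \<delta>_def times_divide_eq_right using \<epsilon>
    by (subst pos_divide_le_eq) (simp_all add: algebra_simps add_pos_nonneg)
  then have g\<delta>: "(norm g)\<^sup>2 * \<delta>\<^sup>2 \<le> \<epsilon>\<^sup>2 / 16"
    using power_mono[of "norm g * \<delta>" "\<epsilon> / 4" 2] \<delta> by (simp add: power_mult_distrib power_divide)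
  obtain K where K: "finite K" "S \<subseteq> (\<Union>f\<in>K. ball f \<delta>)"
    using S \<delta> unfolding compact_eq_totally_bounded by blast
  have "\<forall>f\<in>K. \<exists>U. compact U \<and> stft_energy g (- U) f < \<epsilon>\<^sup>2 / 16"
    using \<epsilon> by (intro ballI stft_energy_tail) simp
  then obtain V where V: "\<And>f. f \<in> K \<Longrightarrow> compact (V f) \<and> stft_energy g (- V f) f < \<epsilon>\<^sup>2 / 16"
    by metis
  define U where "U = (\<Union>f\<in>K. V f)"
  have U: "compact U" unfolding U_def using K V by (intro compact_UN) auto
  have Um: "- U \<in> sets borel" using borel_compact[OF U] by auto
  have "l2_norm_on (- U) (stft g f) \<le> ennreal (\<epsilon> / 2)" if f: "f \<in> S" for f
  proof -
    obtain h where h: "h \<in> K" "dist h f < \<delta>" using K(2) f by auto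
    have "stft_energy g (- U) h \<le> stft_energy g (- V h) h"
      using borel_compact[of "V h"] V[OF h(1)] Um h(1) by (intro stft_energy_mono) (auto simp: U_def)
    with V[OF h(1)] have tail: "stft_energy g (- U) h \<le> \<epsilon>\<^sup>2 / 16" by linarith
    have "stft_energy g (- U) (h - f) \<le> (norm g)\<^sup>2 * (norm (h - f))\<^sup>2"
      by (rule stft_energy_le[OF Um])
    also have "\<dots> \<le> (norm g)\<^sup>2 * \<delta>\<^sup>2"
      using h(2) by (intro mult_left_mono power_mono) (auto simp: dist_norm)
    finally have near: "stft_energy g (- U) (h - f) \<le> \<epsilon>\<^sup>2 / 16" using g\<delta> by linarith
    have "stft_energy g (- U) f \<le> 2 * stft_energy g (- U) h + 2 * stft_energy g (- U) (h - f)"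
      using stft_energy_diff_le[OF Um, of g h "h - f"] by simp
    also have "\<dots> \<le> (\<epsilon> / 2)\<^sup>2"
      using tail near by (simp add: power_divide)
    finally have "sqrt (stft_energy g (- U) f) \<le> \<epsilon> / 2"
      using \<epsilon> by (intro real_le_lsqrt) auto
    then show ?thesis by (simp add: l2_norm_on_stft[OF Um] ennreal_leI)
  qed
  then have "(SUP F\<in>{stft g f |f. f \<in> S}. l2_norm_on (- U) F) \<le> ennreal (\<epsilon> / 2)"
    by (intro SUP_least) auto
  also have "\<dots> < ennreal \<epsilon>" using \<epsilon> by (intro ennreal_lessI) auto
  finally show "\<exists>U. compact U \<and> (SUP F\<in>{stft g f |f. f \<in> S}. l2_norm_on (- U) F) < ennreal \<epsilon>"
    using U by blast
qed

section \<open>Tightness implies total boundedness\<close>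

lemma separated_sequence:
  fixes S :: "'a::metric_space set"
  assumes "\<And>K. finite K \<Longrightarrow> \<not> S \<subseteq> (\<Union>x\<in>K. ball x e)"
  obtains x :: "nat \<Rightarrow> 'a" where "\<And>n. x n \<in> S" "\<And>m n. m < n \<Longrightarrow> e \<le> dist (x m) (x n)"
proof -
  let ?Q = "\<lambda>x n r. r \<in> S \<and> (\<forall>m<(n::nat). e \<le> dist (x m) r)"
  have "\<exists>x. \<forall>n::nat. ?Q x n (x n)"
  proof (rule dependent_wellorder_choice)
    fix n and x :: "nat \<Rightarrow> 'a"
    have "\<not> S \<subseteq> (\<Union>y\<in>x ` {0..<n}. ball y e)" by (rule assms) simp
    then show "\<exists>r. ?Q x n r" by (auto simp: subset_eq not_less)
  qed simp
  then show ?thesis using that by blast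
qed

text \<open>
  A bounded sequence has uniformly bounded and equicontinuous short-time Fourier transforms, so the
  Arzela-Ascoli theorem gives a subsequence that converges uniformly on \<open>U\<close>; two late members of it are
  close on \<open>U\<close>.
\<close>
lemma stft_close_pair_on_compact:
  fixes g :: "'a::euclidean_space l2"
  assumes U: "compact U" and B: "\<And>n. norm (x n) \<le> B" and \<eta>: "0 < \<eta>"
  shows "\<exists>m n::nat. m < n \<and> (\<forall>z\<in>U. norm (stft g (x m - x n) z) \<le> \<eta>)"
proof -
  have "0 \<le> B" using B[of 0] norm_ge_zero order_trans by blast
  obtain G k where "strict_mono (k :: nat \<Rightarrow> nat)"
    and lim: "\<And>e. 0 < e \<Longrightarrow> \<exists>N. \<forall>n z. n \<ge> N \<and> z \<in> U \<longrightarrow> norm (stft g (x (k n)) z - G z) < e"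
  proof (rule Arzela_Ascoli[OF U, of "\<lambda>n. stft g (x n)" "norm g * B"])
    show "norm (stft g (x n) z) \<le> norm g * B" for n z
      using norm_stft_le[of g "x n" z] mult_left_mono[OF B[of n], of "norm g"] by simp
    fix z and e :: real assume "0 < e"
    then have "0 < e / (B + 1)" using \<open>0 \<le> B\<close> by simp
    from stft_equicontinuous[OF this, of z g] obtain d where "d > 0"
      and d: "\<And>y f. norm (z - y) < d \<Longrightarrow> norm (stft g f z - stft g f y) \<le> norm f * (e / (B + 1))" by blast
    have "norm (stft g (x n) z - stft g (x n) y) < e" if "norm (z - y) < d" for n y
    proof -
      have "norm (stft g (x n) z - stft g (x n) y) \<le> norm (x n) * (e / (B + 1))" by (rule d[OF that])
      also have "\<dots> \<le> B * (e / (B + 1))"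
        using B[of n] \<open>0 < e / (B + 1)\<close> by (intro mult_right_mono) auto
      also have "\<dots> < e" using \<open>0 \<le> B\<close> \<open>0 < e\<close> by (simp add: field_simps)
      finally show ?thesis .
    qed
    with \<open>d > 0\<close> show "\<exists>d>0. \<forall>n y. y \<in> U \<and> norm (z - y) < d \<longrightarrow>
        norm (stft g (x n) z - stft g (x n) y) < e" by blast
  qed (use that in blast)
  obtain N where N: "\<And>n z. n \<ge> N \<Longrightarrow> z \<in> U \<Longrightarrow> norm (stft g (x (k n)) z - G z) < \<eta> / 2"
    using lim[of "\<eta> / 2"] \<eta> by auto
  have "norm (stft g (x (k N) - x (k (Suc N))) z) \<le> \<eta>" if z: "z \<in> U" for z
    using N[of N z] N[of "Suc N" z] z
      norm_triangle_ineq4[of "stft g (x (k N)) z - G z" "stft g (x (k (Suc N))) z - G z"]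
    by (simp add: stft_diff)
  moreover have "k N < k (Suc N)" using \<open>strict_mono k\<close> by (simp add: strict_mono_Suc_iff)
  ultimately show ?thesis by blast
qed

text \<open>
  Otherwise \<open>S\<close> contains a sequence of points at mutual distance at least \<open>e\<close>.  Two of its members have
  short-time Fourier transforms that are nearly equal on a compact set \<open>U\<close>, and by tightness both have
  little energy outside \<open>U\<close>.  By Moyal's identity the two members are then closer than \<open>e\<close>.
\<close>
lemma stft_tight_imp_totally_bounded:
  fixes g :: "'a::euclidean_space l2"
  assumes g: "g \<noteq> 0" and S: "bounded S" and tight: "l2_tight {stft g f |f. f \<in> S}" and e: "0 < e"
  shows "\<exists>K. finite K \<and> S \<subseteq> (\<Union>f\<in>K. ball f e)"
proof (rule ccontr)
  assume "\<nexists>K. finite K \<and> S \<subseteq> (\<Union>f\<in>K. ball f e)"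
  then obtain x :: "nat \<Rightarrow> 'a l2" where xS: "\<And>n. x n \<in> S"
      and sep: "\<And>m n. m < n \<Longrightarrow> e \<le> dist (x m) (x n)"
    using separated_sequence[of S e] by metis
  obtain B where B: "\<And>f. f \<in> S \<Longrightarrow> norm f \<le> B" using S by (auto simp: bounded_iff)
  let ?c = "norm g * e"
  have c: "0 < ?c" using g e by simp
  then obtain U where U: "compact U"
      and sup: "(SUP F\<in>{stft g f |f. f \<in> S}. l2_norm_on (- U) F) < ennreal (?c / 4)"
    using tight[unfolded l2_tight_def, rule_format, of "?c / 4"] by auto
  have Um: "U \<in> sets borel" "- U \<in> sets borel" using borel_compact[OF U] by auto
  have tail: "stft_energy g (- U) f \<le> ?c\<^sup>2 / 16" if f: "f \<in> S" for f
  proof -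
    have "l2_norm_on (- U) (stft g f) \<le> (SUP F\<in>{stft g f |f. f \<in> S}. l2_norm_on (- U) F)"
      using f by (intro SUP_upper) auto
    with sup have "ennreal (sqrt (stft_energy g (- U) f)) < ennreal (?c / 4)"
      unfolding l2_norm_on_stft[OF Um(2)] by order
    then have "sqrt (stft_energy g (- U) f) \<le> ?c / 4"
      using c by (simp add: ennreal_less_iff stft_energy_nonneg)
    from real_le_lsqrt[of "stft_energy g (- U) f" "?c / 4"] sqrt_le_D[OF this]
    show ?thesis by (simp add: power_divide)
  qed
  \<comment> \<open>Chosen so that a difference of size \<open>\<eta>\<close> on \<open>U\<close> carries at most a quarter of the energy \<open>?c\<^sup>2\<close>
      of a function of norm \<open>e\<close>; the summand \<open>1\<close> covers null sets \<open>U\<close>.\<close>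
  define \<eta> where "\<eta> = ?c / (2 * sqrt (measure lborel U + 1))"
  have "0 < \<eta>" using c by (simp add: \<eta>_def add_nonneg_pos)
  then obtain m n where "m < n" and small: "\<And>z. z \<in> U \<Longrightarrow> norm (stft g (x m - x n) z) \<le> \<eta>"
    using stft_close_pair_on_compact[OF U, of x B \<eta> g] B xS by blast
  let ?h = "x m - x n"
  have "stft_energy g U ?h \<le> \<eta>\<^sup>2 * measure lborel U"
    by (rule stft_energy_le_sup[OF U small])
  also have "\<dots> \<le> ?c\<^sup>2 / 4"
  proof -
    have pos: "0 < measure lborel U + 1" by (simp add: add_nonneg_pos)
    have eq: "\<eta>\<^sup>2 = (?c\<^sup>2 / 4) / (measure lborel U + 1)"
      using pos by (simp add: \<eta>_def power_divide power_mult_distrib)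
    have "\<eta>\<^sup>2 * measure lborel U \<le> \<eta>\<^sup>2 * (measure lborel U + 1)"
      by (intro mult_left_mono) auto
    also have "\<dots> = ?c\<^sup>2 / 4"
      unfolding eq by (subst times_divide_eq_left, rule nonzero_mult_div_cancel_right) (use pos in linarith)
    finally show ?thesis .
  qed
  finally have inside: "stft_energy g U ?h \<le> ?c\<^sup>2 / 4" .
  have outside: "stft_energy g (- U) ?h \<le> ?c\<^sup>2 / 4"
    using stft_energy_diff_le[OF Um(2), of g "x m" "x n"] tail[OF xS[of m]] tail[OF xS[of n]] by linarith
  have "?c\<^sup>2 \<le> (norm g)\<^sup>2 * (norm ?h)\<^sup>2"
    using sep[OF \<open>m < n\<close>] e by (simp add: power_mult_distrib dist_norm mult_left_mono power_mono)
  also have "\<dots> \<le> ?c\<^sup>2 / 2"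
    using stft_energy_compl[OF Um(1), of g ?h] inside outside by linarith
  finally show False using zero_less_power[OF c, of 2] by linarith
qed

theorem theorem2:
  fixes g :: "(real ^ 'd) l2" and S :: "(real ^ 'd) l2 set"
  assumes "g \<noteq> 0" and "closed S" and "bounded S"
  shows "compact S \<longleftrightarrow> l2_tight {stft g f |f. f \<in> S}"
proof
  assume "compact S"
  then show "l2_tight {stft g f |f. f \<in> S}" by (rule compact_imp_stft_tight)
next
  assume "l2_tight {stft g f |f. f \<in> S}"
  then show "compact S"
    unfolding compact_eq_totally_bounded
    using stft_tight_imp_totally_bounded[OF assms(1,3)] assms(2) by (auto simp: complete_eq_closed)
qed

end
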